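(* Let $\nu$ be a probability measure on $\mathbb{R}$, let $G_0\in\mathbb{R}$ and let $\alpha,\beta\colon[0,\infty)\to\mathbb{R}$ be measurable functions with $\int_0^t|\alpha_s|\,\mathrm{d}s+\int_0^t\beta_s^2\,\mathrm{d}s<\infty$ for all $t\ge 0$ and $\inf_{s\in[0,\infty)}|\beta_s|>0$. Let $g$, $H$, $\delta$ be the functions associated with $(\nu,G_0,\alpha,\beta)$ as defined in the context. Suppose that $g$ and $\delta$ are both Lipschitz continuous with Lipschitz constants $L_g$ and $L_\delta$. Then there exist a Brownian motion $B$, a random time $\tilde\tau\le H^{-1}(L_g^2)$ and a constant $c\in\mathbb{R}$ such that $$c+\int_0^{\tilde\tau}\alpha_s\,\mathrm{d}s+\int_0^{\tilde\tau}\beta_s\,\mathrm{d}B_s$$ has law $\nu$.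
   Context: Setting: $(\Omega,\mathcal{F},(\mathcal{F}_t)_{t\in[0,\infty)},\mathbb{P})$ is a filtered probability space carrying a one-dimensional Brownian motion $W$; $(\mathcal{F}_t)$ is generated by $W$ and augmented by the $\mathbb{P}$-null sets. Definition of $g$: let $F(x):=\nu((-\infty,x])$, $F^{-1}(y):=\inf\{x\in\mathbb{R}: F(x)\ge y\}$ for $y\in(0,1)$, let $\Phi$ be the standard normal distribution function, and set $g:=F^{-1}\circ\Phi\colon\mathbb{R}\to\mathbb{R}$. Definition of $H$ and $\delta$: $H(t):=\int_0^t\beta_s^2\,\mathrm{d}s$ for $t\ge0$; since $\beta$ is bounded away from $0$, $H\colon[0,\infty)\to[0,\infty)$ is a strictly increasing bijection with Lipschitz continuous inverse $H^{-1}$. Put $\hat\delta(t):=G_0+\int_0^t\alpha_s\,\mathrm{d}s$ and $\delta:=\hat\delta\circ H^{-1}\colon[0,\infty)\to\mathbb{R}$. A random time is a $[0,\infty)$-valued random variable (not necessarily a stopping time). The expression $\int_0^{\tilde\tau}\beta_s\,\mathrm{d}B_s$ denotes the continuous process $t\mapsto\int_0^t\beta_s\,\mathrm{d}B_s$ evaluated at $t=\tilde\tau$. *)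

theory Defs
  imports "HOL-Probability.Probability"
begin

definition quantile :: "real measure \<Rightarrow> real \<Rightarrow> real" where
  "quantile \<nu> y = Inf {x. y \<le> cdf \<nu> x}"

definition g_fun :: "real measure \<Rightarrow> real \<Rightarrow> real" where
  "g_fun \<nu> = quantile \<nu> \<circ> cdf std_normal_distribution"

definition H_fun :: "(real \<Rightarrow> real) \<Rightarrow> real \<Rightarrow> real" where
  "H_fun \<beta> t = (LINT s:{0..t}|lborel. (\<beta> s)\<^sup>2)"

(* The inverse of H as a map from {0..} to {0..}; it is a genuine inverse whenever
   H is a bijection of {0..}. *)
definition H_inv :: "(real \<Rightarrow> real) \<Rightarrow> real \<Rightarrow> real" where
  "H_inv \<beta> = inv_into {0..} (H_fun \<beta>)"

definition delta_hat :: "real \<Rightarrow> (real \<Rightarrow> real) \<Rightarrow> real \<Rightarrow> real" where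
  "delta_hat G0 \<alpha> t = G0 + (LINT s:{0..t}|lborel. \<alpha> s)"

definition delta_fun :: "real \<Rightarrow> (real \<Rightarrow> real) \<Rightarrow> (real \<Rightarrow> real) \<Rightarrow> real \<Rightarrow> real" where
  "delta_fun G0 \<alpha> \<beta> = delta_hat G0 \<alpha> \<circ> H_inv \<beta>"

(* Processes have type real => 'a => real; only times t >= 0 are meaningful. *)

definition past_events :: "'a measure \<Rightarrow> (real \<Rightarrow> 'a \<Rightarrow> real) \<Rightarrow> real \<Rightarrow> 'a set set" where
  "past_events M X t = sigma_sets (space M)
     {X s -` A \<inter> space M |s A. 0 \<le> s \<and> s \<le> t \<and> A \<in> sets borel}"

definition augmented_filtration ::
    "'a measure \<Rightarrow> (real \<Rightarrow> 'a \<Rightarrow> real) \<Rightarrow> real \<Rightarrow> 'a measure" where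
  "augmented_filtration M X t = sigma (space M) (past_events M X t \<union> null_sets M)"

(* Standard one-dimensional Brownian motion, relative to its own filtration.
   normal_density takes the standard deviation, hence the square root. *)
locale brownian_motion = prob_space M for M :: "'a measure" +
  fixes B :: "real \<Rightarrow> 'a \<Rightarrow> real"
  assumes measurable_BM: "\<And>t. 0 \<le> t \<Longrightarrow> random_variable borel (B t)"
    and start_BM: "AE \<omega> in M. B 0 \<omega> = 0"
    and continuous_BM: "AE \<omega> in M. continuous_on {0..} (\<lambda>t. B t \<omega>)"
    and normal_increments_BM: "\<And>s t. 0 \<le> s \<Longrightarrow> s < t \<Longrightarrow>
          distributed M lborel (\<lambda>\<omega>. B t \<omega> - B s \<omega>) (\<lambda>x. ennreal (normal_density 0 (sqrt (t - s)) x))"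
    and indep_increments_BM: "\<And>s t. 0 \<le> s \<Longrightarrow> s < t \<Longrightarrow>
          indep_set (past_events M B s)
            {(\<lambda>\<omega>. B t \<omega> - B s \<omega>) -` A \<inter> space M |A. A \<in> sets borel}"

definition random_time :: "'a measure \<Rightarrow> ('a \<Rightarrow> real) \<Rightarrow> bool" where
  "random_time M \<tau> \<longleftrightarrow> \<tau> \<in> borel_measurable M \<and> (\<forall>\<omega>\<in>space M. 0 \<le> \<tau> \<omega>)"

(* A list of triples (a, b, c) encodes the step function which is the sum of the
   functions c * indicator {a<..b}. *)

definition valid_steps :: "(real \<times> real \<times> real) list \<Rightarrow> bool" where
  "valid_steps xs \<longleftrightarrow> (\<forall>(a, b, c) \<in> set xs. 0 \<le> a \<and> a \<le> b)"

definition step_fun :: "(real \<times> real \<times> real) list \<Rightarrow> real \<Rightarrow> real" where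
  "step_fun xs s = (\<Sum>(a, b, c)\<leftarrow>xs. c * indicator {a<..b} s)"

definition step_integral ::
    "(real \<Rightarrow> 'a \<Rightarrow> real) \<Rightarrow> (real \<times> real \<times> real) list \<Rightarrow> real \<Rightarrow> 'a \<Rightarrow> real" where
  "step_integral B xs t \<omega> = (\<Sum>(a, b, c)\<leftarrow>xs. c * (B (min b t) \<omega> - B (min a t) \<omega>))"

(* I is (a version with continuous paths of) the stochastic integral process
   "integral of \<beta> dB over [0, t]" of a deterministic, locally square integrable
   integrand \<beta>: each I t is the L2(M)-limit of the elementary integrals of step
   functions converging to \<beta> in L2([0, t]).  By the Ito isometry the limit does not
   depend on the approximating sequence, so I is unique up to indistinguishability.
   The errors are nonnegative Lebesgue integrals, so they are infinite, rather than 0,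
   when the integrand fails to be square integrable. *)
definition is_stochastic_integral ::
    "'a measure \<Rightarrow> (real \<Rightarrow> real) \<Rightarrow> (real \<Rightarrow> 'a \<Rightarrow> real) \<Rightarrow> (real \<Rightarrow> 'a \<Rightarrow> real) \<Rightarrow> bool" where
  "is_stochastic_integral M \<beta> B I \<longleftrightarrow>
     (\<forall>t\<ge>0. I t \<in> borel_measurable M) \<and>
     (\<forall>\<omega>\<in>space M. continuous_on {0..} (\<lambda>t. I t \<omega>)) \<and>
     (\<forall>t\<ge>0. \<exists>xs. (\<forall>n. valid_steps (xs n)) \<and>
        (\<lambda>n. \<integral>\<^sup>+s\<in>{0..t}. ennreal ((step_fun (xs n) s - \<beta> s)\<^sup>2) \<partial>lborel) \<longlonglongrightarrow> 0 \<and>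
        (\<lambda>n::nat. \<integral>\<^sup>+\<omega>. ennreal ((step_integral B (xs n) t \<omega> - I t \<omega>)\<^sup>2) \<partial>M) \<longlonglongrightarrow> 0)"

end

theory Submission
  imports Defs
begin

text \<open>
  Since a random time may look into the future, no time change is needed: take \<open>B = W\<close>, let
  \<open>I\<close> be the continuous Wiener integral of \<open>\<beta>\<close>, and put \<open>T = H\<^sup>-\<^sup>1(L\<^sub>g\<^sup>2)\<close>. Then
  \<open>I\<^sub>T\<close> is centred normal with variance \<open>L\<^sub>g\<^sup>2\<close>, so \<open>I\<^sub>T = L\<^sub>g Z\<close> with \<open>Z\<close> standard normal,
  and \<open>g(Z)\<close> has law \<open>\<nu>\<close>. With \<open>A\<^sub>t\<close> the integral of \<open>\<alpha>\<close> over \<open>[0, t]\<close>, choose \<open>z\<^sub>0\<close> such that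
  \<open>A\<^sub>T + L\<^sub>g z\<^sub>0 = 0\<close>. As \<open>g\<close> is nondecreasing and \<open>L\<^sub>g\<close>-Lipschitz, \<open>g(Z) - g(z\<^sub>0)\<close> lies between \<open>0\<close> and
  \<open>L\<^sub>g (Z - z\<^sub>0) = A\<^sub>T + I\<^sub>T\<close>, so the continuous path \<open>A + I\<close>, which starts at \<open>0\<close>, attains this value
  before \<open>T\<close>. The first such time is \<open>\<tau>\<close>, and \<open>c = g(z\<^sub>0)\<close>.

  The continuous version of the Wiener integral comes from step functions approximating \<open>\<beta>\<close> in
  \<open>L\<^sup>2([0, n])\<close> up to an error \<open>8\<^sup>-\<^sup>n\<close>: by Kolmogorov's maximal inequality and the Borel-Cantelli
  lemma their integrals converge locally uniformly almost surely.
\<close>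

subsection \<open>Step functions and their density in \<open>L\<^sup>2\<close>\<close>

lemma step_fun_simps [simp]:
  "step_fun [] s = 0"
  "step_fun ((a, b, c) # xs) s = c * indicator {a<..b} s + step_fun xs s"
  "step_fun (xs @ ys) s = step_fun xs s + step_fun ys s"
  by (auto simp: step_fun_def)

lemma step_integral_simps [simp]:
  "step_integral B [] t \<omega> = 0"
  "step_integral B ((a, b, c) # xs) t \<omega> = c * (B (min b t) \<omega> - B (min a t) \<omega>) + step_integral B xs t \<omega>"
  "step_integral B (xs @ ys) t \<omega> = step_integral B xs t \<omega> + step_integral B ys t \<omega>"
  by (auto simp: step_integral_def)

lemma valid_steps_simps [simp]:
  "valid_steps []"
  "valid_steps ((a, b, c) # xs) \<longleftrightarrow> 0 \<le> a \<and> a \<le> b \<and> valid_steps xs"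
  "valid_steps (xs @ ys) \<longleftrightarrow> valid_steps xs \<and> valid_steps ys"
  by (force simp: valid_steps_def)+

lemma borel_measurable_step_fun [measurable]: "step_fun xs \<in> borel_measurable borel"
proof (induction xs)
  case Nil
  have "step_fun [] = (\<lambda>_. 0)" by (simp add: fun_eq_iff)
  then show ?case by simp
next
  case (Cons x xs)
  obtain a b c where x: "x = (a, b, c)" by (cases x)
  have "step_fun (x # xs) = (\<lambda>s. c * indicator {a<..b} s + step_fun xs s)"
    by (simp add: fun_eq_iff x)
  then show ?case using Cons by simp
qed

text \<open>Together with \<open>@\<close> this turns the difference of two step integrals into a
  single step integral, so that estimates for one list also cover differences.\<close>

definition neg_steps :: "(real \<times> real \<times> real) list \<Rightarrow> (real \<times> real \<times> real) list" where
  "neg_steps xs = map (\<lambda>(a, b, c). (a, b, - c)) xs"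

lemma neg_steps_simps [simp]:
  "step_fun (neg_steps xs) s = - step_fun xs s"
  "step_integral B (neg_steps xs) t \<omega> = - step_integral B xs t \<omega>"
  "valid_steps (neg_steps xs) \<longleftrightarrow> valid_steps xs"
  by (induction xs) (auto simp: neg_steps_def)

text \<open>The cells are adjacent and listed in order of time, unlike the intervals of a general
  step list. Appending a cell therefore adds an increment independent of the earlier ones, which
  later yields the Gaussian law.\<close>

definition grid_steps :: "nat \<Rightarrow> (nat \<Rightarrow> real) \<Rightarrow> nat \<Rightarrow> (real \<times> real \<times> real) list" where
  "grid_steps m c k = map (\<lambda>j. (real j / real m, real (Suc j) / real m, c j)) [0..<k]"

lemma grid_steps_simps [simp]:
  "grid_steps m c 0 = []"
  "grid_steps m c (Suc k) = grid_steps m c k @ [(real k / real m, real (Suc k) / real m, c k)]"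
  by (auto simp: grid_steps_def)

lemma valid_grid_steps [simp]: "valid_steps (grid_steps m c k)"
  by (induction k) (auto simp: divide_right_mono)

text \<open>Cells are open on the left, so \<open>s\<close> lies in the cell of index
  \<open>\<lceil>real m * s\<rceil> - 1\<close>, and no cell contains 0.\<close>

lemma step_fun_grid_steps:
  assumes "0 < m"
  shows "step_fun (grid_steps m c k) s =
    (if 0 < s \<and> real m * s \<le> real k then c (nat \<lceil>real m * s\<rceil> - 1) else 0)"
proof (induction k)
  case 0
  then show ?case using assms by (auto simp: mult_le_0_iff)
next
  case (Suc k)
  have *: "real k / real m < s \<and> s \<le> real (Suc k) / real m \<longleftrightarrow>
      real k < real m * s \<and> real m * s \<le> real (Suc k)"
    using assms by (auto simp: field_simps)
  show ?case
  proof (cases "real k < real m * s \<and> real m * s \<le> real (Suc k)")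
    case True
    then have "\<lceil>real m * s\<rceil> = int (Suc k)"
      by (intro ceiling_unique) auto
    moreover have "0 < s"
      using True assms by (metis of_nat_0_le_iff order_le_less_trans zero_less_mult_pos of_nat_0_less_iff)
    ultimately show ?thesis
      using True Suc * by (auto simp: indicator_def nat_add_distrib)
  next
    case False
    then show ?thesis using Suc * by (auto simp: indicator_def)
  qed
qed

text \<open>A squared distance, which explains the factors 2 in its triangle inequality.\<close>

definition L2_err :: "(real \<Rightarrow> real) \<Rightarrow> (real \<Rightarrow> real) \<Rightarrow> real \<Rightarrow> ennreal" where
  "L2_err f g t = (\<integral>\<^sup>+s\<in>{0..t}. ennreal ((f s - g s)\<^sup>2) \<partial>lborel)"

lemma L2_err_commute: "L2_err f g t = L2_err g f t"
  by (simp add: L2_err_def power2_commute)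

lemma L2_err_mono: "s \<le> t \<Longrightarrow> L2_err f g s \<le> L2_err f g t"
  unfolding L2_err_def by (intro nn_integral_mono) (auto simp: indicator_def)

lemma L2_err_triangle:
  assumes [measurable]: "f \<in> borel_measurable borel" "g \<in> borel_measurable borel" "h \<in> borel_measurable borel"
  shows "L2_err f h t \<le> 2 * L2_err f g t + 2 * L2_err g h t"
proof -
  have "L2_err f h t \<le> (\<integral>\<^sup>+s. 2 * (ennreal ((f s - g s)\<^sup>2) * indicator {0..t} s)
      + 2 * (ennreal ((g s - h s)\<^sup>2) * indicator {0..t} s) \<partial>lborel)"
    unfolding L2_err_def
  proof (intro nn_integral_mono)
    fix s :: real
    have "(f s - h s)\<^sup>2 \<le> 2 * (f s - g s)\<^sup>2 + 2 * (g s - h s)\<^sup>2"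
      using zero_le_power2[of "(f s - g s) - (g s - h s)"] by (simp add: power2_eq_square algebra_simps)
    then have "ennreal ((f s - h s)\<^sup>2) \<le> 2 * ennreal ((f s - g s)\<^sup>2) + 2 * ennreal ((g s - h s)\<^sup>2)"
      by (simp flip: ennreal_numeral ennreal_mult' ennreal_plus add: ennreal_leI)
    then show "ennreal ((f s - h s)\<^sup>2) * indicator {0..t} s \<le> 2 * (ennreal ((f s - g s)\<^sup>2) * indicator {0..t} s)
      + 2 * (ennreal ((g s - h s)\<^sup>2) * indicator {0..t} s)"
      by (auto simp: indicator_def)
  qed
  also have "\<dots> = 2 * L2_err f g t + 2 * L2_err g h t"
    unfolding L2_err_def by (subst nn_integral_add) (auto simp: nn_integral_cmult)
  finally show ?thesis .
qed

text \<open>The approximants are grid step functions from the start, because the law of the integral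
  is computed for these.\<close>

definition step_approximable :: "real \<Rightarrow> (real \<Rightarrow> real) \<Rightarrow> bool" where
  "step_approximable t f \<longleftrightarrow> (\<forall>\<epsilon>>0. \<exists>m c k. L2_err (step_fun (grid_steps m c k)) f t \<le> ennreal \<epsilon>)"

text \<open>An error of \<epsilon>/4 is spent on passing to some \<open>u n\<close> and another on
  approximating \<open>u n\<close>; the triangle inequality doubles both.\<close>

lemma step_approximable_limit:
  assumes [measurable]: "f \<in> borel_measurable borel" "\<And>n. u n \<in> borel_measurable borel"
    and u: "\<And>n::nat. step_approximable t (u n)" and lim: "(\<lambda>n. L2_err (u n) f t) \<longlonglongrightarrow> 0"
  shows "step_approximable t f"
  unfolding step_approximable_def
proof safe
  fix \<epsilon> :: real assume "0 < \<epsilon>"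
  then have "\<forall>\<^sub>F n in sequentially. L2_err (u n) f t < ennreal (\<epsilon> / 4)"
    using lim by (intro order_tendstoD(2)) auto
  then obtain n where n: "L2_err (u n) f t < ennreal (\<epsilon> / 4)"
    by (auto simp: eventually_sequentially)
  obtain m c k where *: "L2_err (step_fun (grid_steps m c k)) (u n) t \<le> ennreal (\<epsilon> / 4)"
    using u[of n] \<open>0 < \<epsilon>\<close> unfolding step_approximable_def by (meson divide_pos_pos zero_less_numeral)
  have "L2_err (step_fun (grid_steps m c k)) f t
      \<le> 2 * L2_err (step_fun (grid_steps m c k)) (u n) t + 2 * L2_err (u n) f t"
    by (rule L2_err_triangle) auto
  also have "\<dots> \<le> 2 * ennreal (\<epsilon> / 4) + 2 * ennreal (\<epsilon> / 4)"
    using n * by (intro add_mono mult_left_mono) auto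
  also have "\<dots> = ennreal \<epsilon>"
    using \<open>0 < \<epsilon>\<close> by (simp flip: ennreal_numeral ennreal_mult' ennreal_plus)
  finally show "\<exists>m c k. L2_err (step_fun (grid_steps m c k)) f t \<le> ennreal \<epsilon>" by blast
qed

lemma L2_err_dominated_convergence:
  assumes [measurable]: "f \<in> borel_measurable borel" "\<And>n. u n \<in> borel_measurable borel" "w \<in> borel_measurable borel"
    and w: "(\<integral>\<^sup>+s\<in>{0..t}. ennreal (w s) \<partial>lborel) < \<infinity>"
    and bound: "\<And>n s. (u n s - f s)\<^sup>2 \<le> w s"
    and lim: "AE s in lborel. (\<lambda>n::nat. u n s) \<longlonglongrightarrow> f s"
  shows "(\<lambda>n. L2_err (u n) f t) \<longlonglongrightarrow> 0"
proof -
  have "(\<lambda>n. L2_err (u n) f t) \<longlonglongrightarrow> (\<integral>\<^sup>+(s::real). 0 \<partial>lborel)"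
    unfolding L2_err_def
  proof (rule nn_integral_dominated_convergence[where w="\<lambda>s. ennreal (w s) * indicator {0..t} s"])
    show "AE s in lborel. (\<lambda>n. ennreal ((u n s - f s)\<^sup>2) * indicator {0..t} s) \<longlonglongrightarrow> 0"
      using lim
    proof eventually_elim
      case (elim s)
      have "(\<lambda>n. ennreal ((u n s - f s)\<^sup>2)) \<longlonglongrightarrow> ennreal ((f s - f s)\<^sup>2)"
        using elim by (intro tendsto_intros)
      then show ?case by (auto simp: indicator_def)
    qed
    show "AE s in lborel. ennreal ((u n s - f s)\<^sup>2) * indicator {0..t} s \<le> ennreal (w s) * indicator {0..t} s" for n
      using bound by (intro AE_I2) (auto simp: indicator_def ennreal_leI)
  qed (use w in auto)
  then show ?thesis by simp
qed

text \<open>By uniform continuity on the compact interval, sampling \<open>h\<close> at the right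
  end points of a fine grid gives a uniformly close step function. Since \<open>N\<close> is a
  natural number, \<open>N * m\<close> cells fill the interval exactly.\<close>

lemma step_approximable_continuous:
  assumes h: "continuous_on UNIV h"
  shows "step_approximable (real N) h"
  unfolding step_approximable_def
proof safe
  fix \<epsilon> :: real assume "0 < \<epsilon>"
  \<comment> \<open>Chosen so that \<open>e\<^sup>2 * real N\<close> is at most \<epsilon>; the
    \<open>+ 1\<close> covers \<open>N = 0\<close>.\<close>
  define e where "e = sqrt (\<epsilon> / (real N + 1))"
  have "0 < e" using \<open>0 < \<epsilon>\<close> by (simp add: e_def)
  have "uniformly_continuous_on {0..real N} h"
    using h by (intro compact_uniformly_continuous) (auto intro: continuous_on_subset)
  then obtain d where "0 < d" and d: "\<And>x y. x \<in> {0..real N} \<Longrightarrow> y \<in> {0..real N} \<Longrightarrow> \<bar>y - x\<bar> < d \<Longrightarrow> \<bar>h y - h x\<bar> < e"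
    using \<open>0 < e\<close> unfolding uniformly_continuous_on_def dist_real_def by metis
  obtain m where m: "0 < m" "1 / real m < d"
    using \<open>0 < d\<close> by (metis inverse_eq_divide reals_Archimedean zero_less_Suc)
  let ?c = "\<lambda>j. h (real (Suc j) / real m)" and ?k = "N * m"
  have close: "\<bar>step_fun (grid_steps m ?c ?k) s - h s\<bar> < e" if s: "0 < s" "s \<le> real N" for s
  proof -
    \<comment> \<open>\<open>y\<close> is the right end point of the cell containing
      \<open>s\<close>, so the step function takes the value \<open>h y\<close> at
      \<open>s\<close>.\<close>
    define y where "y = real_of_int \<lceil>real m * s\<rceil> / real m"
    have pos: "0 < real m * s" using s m by simp
    then have "1 \<le> \<lceil>real m * s\<rceil>" by linarith
    then have suc: "real (Suc (nat \<lceil>real m * s\<rceil> - 1)) = real_of_int \<lceil>real m * s\<rceil>"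
      by (simp add: of_nat_diff nat_le_iff Suc_diff_le)
    have le: "real m * s \<le> real ?k" using s m by (simp add: mult.commute)
    then have "\<lceil>real m * s\<rceil> \<le> int ?k" by (simp add: ceiling_le_iff)
    then have "real_of_int \<lceil>real m * s\<rceil> \<le> real ?k" by linarith
    then have "y \<le> real N" using m by (simp add: y_def field_simps)
    moreover have "s \<le> y" using m by (simp add: y_def field_simps)
    moreover have "y < s + 1 / real m"
    proof -
      have "real_of_int \<lceil>real m * s\<rceil> < real m * s + 1" by linarith
      then show ?thesis using m by (simp add: y_def field_simps)
    qed
    ultimately have "\<bar>h y - h s\<bar> < e" using s m by (intro d) auto
    moreover have "step_fun (grid_steps m ?c ?k) s = h y"
      unfolding y_def suc[symmetric] using s le m by (subst step_fun_grid_steps) auto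
    ultimately show ?thesis by simp
  qed
  have "L2_err (step_fun (grid_steps m ?c ?k)) h N \<le> (\<integral>\<^sup>+s\<in>{0..real N}. ennreal (e\<^sup>2) \<partial>lborel)"
    unfolding L2_err_def
  \<comment> \<open>The cells miss the point 0, hence the comparison almost everywhere.\<close>
  proof (intro nn_integral_mono_AE, use AE_lborel_singleton[of 0] in eventually_elim)
    case (elim s)
    show ?case
    proof (cases "s \<in> {0..real N}")
      case True
      then have "\<bar>step_fun (grid_steps m ?c ?k) s - h s\<bar> \<le> \<bar>e\<bar>"
        using close[of s] elim \<open>0 < e\<close> by auto
      then have "(step_fun (grid_steps m ?c ?k) s - h s)\<^sup>2 \<le> e\<^sup>2" by (simp only: abs_le_square_iff)
      then show ?thesis by (simp add: ennreal_leI mult_right_mono)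
    qed auto
  qed
  also have "\<dots> = ennreal (e\<^sup>2) * ennreal (real N)"
    by (simp add: nn_integral_cmult_indicator)
  also have "\<dots> = ennreal (e\<^sup>2 * real N)" by (simp add: ennreal_mult)
  also have "\<dots> \<le> ennreal \<epsilon>"
    using \<open>0 < \<epsilon>\<close> by (intro ennreal_leI) (simp add: e_def field_simps)
  finally show "\<exists>m c k. L2_err (step_fun (grid_steps m c k)) h (real N) \<le> ennreal \<epsilon>" by blast
qed

text \<open>A measurable function is an almost everywhere limit of continuous ones. Clamping these
  to the range from \<open>- K\<close> to \<open>K\<close> preserves continuity and the limit, and
  bounds the squared error by a constant.\<close>

lemma step_approximable_bounded:
  assumes [measurable]: "f \<in> borel_measurable borel" and K: "\<And>s. \<bar>f s\<bar> \<le> K"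
  shows "step_approximable (real N) f"
proof -
  have "f \<in> borel_measurable lebesgue"
    using assms(1) by (intro measurable_completion) simp
  then have "f measurable_on UNIV"
    by (intro lebesgue_measurable_imp_measurable_on_real) auto
  then obtain Z u where Z: "negligible Z" and u: "\<And>n. continuous_on UNIV (u n)"
    and lim: "\<And>s. s \<notin> Z \<Longrightarrow> (\<lambda>n::nat. u n s) \<longlonglongrightarrow> f s"
    unfolding measurable_on_def by auto
  define v where "v n s = max (- K) (min K (u n s))" for n s
  have cont: "continuous_on UNIV (v n)" for n
    unfolding v_def by (intro continuous_intros u)
  then have [measurable]: "v n \<in> borel_measurable borel" for n
    by (rule borel_measurable_continuous_onI)
  have "0 \<le> K" using K[of 0] by linarith
  have Z0: "AE s in lborel. s \<notin> Z"
  proof -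
    have "AE s in lebesgue. s \<notin> Z"
      using Z by (auto simp: negligible_iff_null_sets intro: AE_not_in)
    then show ?thesis by (simp add: AE_completion_iff)
  qed
  show ?thesis
  proof (rule step_approximable_limit[where u=v])
    show "step_approximable (real N) (v n)" for n
      by (rule step_approximable_continuous[OF cont])
    show "(\<lambda>n. L2_err (v n) f (real N)) \<longlonglongrightarrow> 0"
    proof (rule L2_err_dominated_convergence[where w="\<lambda>_. (2 * K)\<^sup>2"])
      show "(v n s - f s)\<^sup>2 \<le> (2 * K)\<^sup>2" for n s
      proof -
        have "\<bar>v n s - f s\<bar> \<le> \<bar>2 * K\<bar>" using K[of s] \<open>0 \<le> K\<close> by (auto simp: v_def)
        then show ?thesis by (simp only: abs_le_square_iff)
      qed
      show "AE s in lborel. (\<lambda>n. v n s) \<longlonglongrightarrow> f s" using Z0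
      proof eventually_elim
        case (elim s)
        have "(\<lambda>n. v n s) \<longlonglongrightarrow> max (- K) (min K (f s))"
          unfolding v_def by (intro tendsto_intros lim elim)
        then show ?case using K[of s] by (simp add: max_def min_def abs_le_iff split: if_splits)
      qed
    qed (auto simp: nn_integral_cmult_indicator ennreal_mult_less_top)
  qed auto
qed

text \<open>Replacing values of modulus above \<open>n\<close> by 0 gives bounded functions whose
  squared error is dominated by \<open>(f s)\<^sup>2\<close>.\<close>

lemma step_approximable_L2:
  assumes [measurable]: "f \<in> borel_measurable borel"
    and f: "(\<integral>\<^sup>+s\<in>{0..real N}. ennreal ((f s)\<^sup>2) \<partial>lborel) < \<infinity>"
  shows "step_approximable (real N) f"
proof (rule step_approximable_limit[where u="\<lambda>n s. if \<bar>f s\<bar> \<le> real n then f s else 0"])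
  show "step_approximable (real N) (\<lambda>s. if \<bar>f s\<bar> \<le> real n then f s else 0)" for n
    by (rule step_approximable_bounded[where K="real n"]) auto
  show "(\<lambda>n. L2_err (\<lambda>s. if \<bar>f s\<bar> \<le> real n then f s else 0) f (real N)) \<longlonglongrightarrow> 0"
  proof (rule L2_err_dominated_convergence[where w="\<lambda>s. (f s)\<^sup>2"])
    show "AE s in lborel. (\<lambda>n. if \<bar>f s\<bar> \<le> real n then f s else 0) \<longlonglongrightarrow> f s"
    proof (intro AE_I2 tendsto_eventually)
      fix s
      show "\<forall>\<^sub>F n in sequentially. (if \<bar>f s\<bar> \<le> real n then f s else 0) = f s"
        using eventually_ge_at_top[of "nat \<lceil>\<bar>f s\<bar>\<rceil>"]
        by eventually_elim (simp add: nat_le_iff ceiling_le_iff)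
    qed
  qed (use f in auto)
qed auto

subsection \<open>Elementary integrals against Brownian motion\<close>

text \<open>The covariance of Brownian motion at two times is their minimum. The left side is thus
  the covariance of two increments stopped at \<open>t\<close>, the right side the length of the
  overlap of \<open>{a<..b}\<close>, \<open>{c<..d}\<close> and \<open>{..t}\<close>.\<close>

lemma min_min_increment:
  fixes a b c d t :: real
  assumes "a \<le> b" "c \<le> d"
  shows "min (min b t) (min d t) - min (min b t) (min c t) - min (min a t) (min d t) + min (min a t) (min c t)
    = max 0 (min (min b d) t - max a c)"
proof -
  have *: "min q u - min q r - min p u + min p r = max 0 (min q u - max p r)"
    if "p \<le> q" "r \<le> u" for p q r u :: real
    using that by (cases "p \<le> r"; cases "q \<le> u"; cases "q \<le> r"; cases "p \<le> u") (simp_all add: min_def max_def)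
  have "min (min b t) (min d t) - min (min b t) (min c t) - min (min a t) (min d t) + min (min a t) (min c t)
      = max 0 (min (min b t) (min d t) - max (min a t) (min c t))"
    by (rule *) (use assms in \<open>auto intro!: min.mono\<close>)
  also have "\<dots> = max 0 (min (min b d) t - min (max a c) t)"
    by (cases "a \<le> c"; cases "b \<le> d") (auto simp: max_def min_def)
  \<comment> \<open>If \<open>max a c\<close> exceeds \<open>t\<close>, both differences are at most
    0 and the outer \<open>max\<close> removes them.\<close>
  also have "\<dots> = max 0 (min (min b d) t - max a c)"
    by (cases "max a c \<le> t") (simp_all add: max_def)
  finally show ?thesis .
qed

context brownian_motion
begin

text \<open>A measure space, so that measurability of random variables can refer to it. Null sets
  are not added: independence of increments is assumed for exactly these events.\<close>

definition past :: "real \<Rightarrow> 'a measure" where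
  "past t = sigma (space M) (past_events M B t)"

lemma past_events_subset_Pow: "past_events M B t \<subseteq> Pow (space M)"
proof -
  have "{B s -` A \<inter> space M |s A. 0 \<le> s \<and> s \<le> t \<and> A \<in> sets borel} \<subseteq> Pow (space M)"
    by auto
  from sigma_sets_into_sp[OF this] show ?thesis
    unfolding past_events_def by blast
qed

lemma space_past [simp]: "space (past t) = space M"
  using past_events_subset_Pow by (simp add: past_def)

lemma sets_past: "sets (past t) = past_events M B t"
proof -
  have "sets (past t) = sigma_sets (space M) (past_events M B t)"
    using past_events_subset_Pow unfolding past_def by (rule sets_measure_of)
  also have "\<dots> = past_events M B t"
    unfolding past_events_def by (rule sigma_sets_sigma_sets_eq) auto
  finally show ?thesis .
qed

lemma measurable_past:
  assumes "0 \<le> s" "s \<le> t"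
  shows "B s \<in> borel_measurable (past t)"
proof (rule measurableI)
  fix A :: "real set" assume "A \<in> sets borel"
  then show "B s -` A \<inter> space (past t) \<in> sets (past t)"
    using assms unfolding sets_past past_events_def space_past by (intro sigma_sets.Basic) blast
qed auto

lemma sets_past_subset: "sets (past t) \<subseteq> sets M"
proof -
  have "{B s -` A \<inter> space M |s A. 0 \<le> s \<and> s \<le> t \<and> A \<in> sets borel} \<subseteq> sets M"
    using measurable_BM by (auto intro: measurable_sets)
  then show ?thesis by (auto simp: sets_past past_events_def dest: sets.sigma_sets_subset)
qed

lemma measurable_from_past: "Z \<in> measurable (past t) N \<Longrightarrow> Z \<in> measurable M N"
  using sets_past_subset by (auto simp: measurable_def)

lemma indep_set_mono_left: "indep_set \<A> \<C> \<Longrightarrow> \<A>' \<subseteq> \<A> \<Longrightarrow> indep_set \<A>' \<C>"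
  unfolding indep_sets2_eq by blast

text \<open>Carries independence from events over to random variables: the preimages under
  \<open>Z\<close> generate a part of the past, and the preimages under the increment already form a
  \<sigma>-algebra.\<close>

lemma indep_past_increment:
  assumes "0 \<le> s" "s < t" and Z: "Z \<in> measurable (past s) N"
  shows "indep_var N Z borel (\<lambda>\<omega>. B t \<omega> - B s \<omega>)"
  unfolding indep_var_eq
proof (intro conjI)
  show "random_variable N Z" using Z by (rule measurable_from_past)
  show incr: "random_variable borel (\<lambda>\<omega>. B t \<omega> - B s \<omega>)"
    using assms measurable_BM by auto
  let ?G = "{(\<lambda>\<omega>. B t \<omega> - B s \<omega>) -` A \<inter> space M |A. A \<in> sets borel}"
  have "sigma_sets (space M) ?G = ?G"
    using sigma_sets_vimage_commute[of "\<lambda>\<omega>. B t \<omega> - B s \<omega>" "space M" UNIV "sets borel"]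
      sets.sigma_sets_eq[of "borel :: real measure"] by simp
  moreover have "sigma_sets (space M) {Z -` A \<inter> space M |A. A \<in> sets N} \<subseteq> past_events M B s"
  proof -
    have "{Z -` A \<inter> space M |A. A \<in> sets N} \<subseteq> sets (past s)"
      using Z by (auto dest: measurable_sets)
    then show ?thesis
      using sets.sigma_sets_subset[of _ "past s"] by (simp add: sets_past)
  qed
  ultimately show "indep_set (sigma_sets (space M) {Z -` A \<inter> space M |A. A \<in> sets N})
      (sigma_sets (space M) ?G)"
    using indep_set_mono_left[OF indep_increments_BM[OF assms(1,2)]] by simp
qed

lemma increment_moments:
  assumes "0 \<le> s" "s \<le> t"
  shows integrable_increment: "integrable M (\<lambda>\<omega>. B t \<omega> - B s \<omega>)"
    and expectation_increment: "expectation (\<lambda>\<omega>. B t \<omega> - B s \<omega>) = 0"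
    and integrable_increment_square: "integrable M (\<lambda>\<omega>. (B t \<omega> - B s \<omega>)\<^sup>2)"
    and expectation_increment_square: "expectation (\<lambda>\<omega>. (B t \<omega> - B s \<omega>)\<^sup>2) = t - s"
proof -
  have "integrable M (\<lambda>\<omega>. B t \<omega> - B s \<omega>) \<and> expectation (\<lambda>\<omega>. B t \<omega> - B s \<omega>) = 0 \<and>
    integrable M (\<lambda>\<omega>. (B t \<omega> - B s \<omega>)\<^sup>2) \<and> expectation (\<lambda>\<omega>. (B t \<omega> - B s \<omega>)\<^sup>2) = t - s"
  \<comment> \<open>For \<open>s = t\<close> the increment is 0, a degenerate law that
    \<open>normal_increments_BM\<close> does not cover.\<close>
  proof (cases "s = t")
    case False
    then have pos: "0 < sqrt (t - s)" using assms by simp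
    have D: "distributed M lborel (\<lambda>\<omega>. B t \<omega> - B s \<omega>) (\<lambda>x. ennreal (normal_density 0 (sqrt (t - s)) x))"
      using assms False by (intro normal_increments_BM) auto
    have mom: "integrable M (\<lambda>\<omega>. (B t \<omega> - B s \<omega>) ^ k)" for k
      using integrable_normal_moment[OF pos, of 0 k]
      by (subst distributed_integrable[OF D, of "\<lambda>x. x ^ k", symmetric]) auto
    show ?thesis
    proof (intro conjI)
      show "integrable M (\<lambda>\<omega>. B t \<omega> - B s \<omega>)" using mom[of 1] by simp
      show E: "expectation (\<lambda>\<omega>. B t \<omega> - B s \<omega>) = 0"
        by (rule normal_distributed_expectation[OF pos D])
      show "integrable M (\<lambda>\<omega>. (B t \<omega> - B s \<omega>)\<^sup>2)" by (rule mom)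
      show "expectation (\<lambda>\<omega>. (B t \<omega> - B s \<omega>)\<^sup>2) = t - s"
        using normal_distributed_variance[OF pos D] assms unfolding E by simp
    qed
  qed auto
  then show "integrable M (\<lambda>\<omega>. B t \<omega> - B s \<omega>)" "expectation (\<lambda>\<omega>. B t \<omega> - B s \<omega>) = 0"
    "integrable M (\<lambda>\<omega>. (B t \<omega> - B s \<omega>)\<^sup>2)" "expectation (\<lambda>\<omega>. (B t \<omega> - B s \<omega>)\<^sup>2) = t - s"
    by auto
qed

text \<open>By independence the expectation of the product factors, and the increment is centred.
  The increment may begin later than the time \<open>r\<close> up to which \<open>Z\<close>
  looks.\<close>

lemma has_bochner_integral_past_times_increment:
  assumes "0 \<le> r" "r \<le> s" "s \<le> t" and Z: "Z \<in> borel_measurable (past r)" "integrable M Z"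
  shows "has_bochner_integral M (\<lambda>\<omega>. Z \<omega> * (B t \<omega> - B s \<omega>)) (0 :: real)"
proof (cases "s = t")
  case True
  then show ?thesis by (simp add: has_bochner_integral_zero)
next
  case False
  have "past_events M B r \<subseteq> past_events M B s"
    unfolding past_events_def using \<open>r \<le> s\<close> by (intro sigma_sets_mono') force
  then have "Z \<in> borel_measurable (past s)"
    using Z(1) unfolding measurable_def sets_past space_past by blast
  then have ind: "indep_var borel Z borel (\<lambda>\<omega>. B t \<omega> - B s \<omega>)"
    using assms False by (intro indep_past_increment) auto
  have incr: "integrable M (\<lambda>\<omega>. B t \<omega> - B s \<omega>)" "expectation (\<lambda>\<omega>. B t \<omega> - B s \<omega>) = 0"
    using assms by (auto intro!: integrable_increment expectation_increment)
  show ?thesis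
    using indep_var_integrable[OF ind Z(2) incr(1)] indep_var_lebesgue_integral[OF ind Z(2) incr(1)] incr(2)
    by (simp add: has_bochner_integral_iff)
qed

text \<open>As \<open>B 0\<close> vanishes only almost surely, the moments of \<open>B t\<close> are
  transferred from those of the increment along this identity.\<close>

lemma AE_increment_from_0: "AE \<omega> in M. B t \<omega> - B 0 \<omega> = B t \<omega>"
  using start_BM by eventually_elim simp

lemma integrable_BM: "0 \<le> t \<Longrightarrow> integrable M (B t)"
  using integrable_increment[of 0 t] AE_increment_from_0[of t]
  by (subst integrable_cong_AE[where g="\<lambda>\<omega>. B t \<omega> - B 0 \<omega>"])
    (auto intro!: measurable_BM borel_measurable_diff elim: eventually_mono)

lemma has_bochner_integral_BM_square: "0 \<le> t \<Longrightarrow> has_bochner_integral M (\<lambda>\<omega>. B t \<omega> * B t \<omega>) t"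
  using integrable_increment_square[of 0 t] expectation_increment_square[of 0 t] AE_increment_from_0[of t]
  by (subst has_bochner_integral_cong_AE[where g="\<lambda>\<omega>. (B t \<omega> - B 0 \<omega>)\<^sup>2"])
    (auto intro!: measurable_BM borel_measurable_power borel_measurable_times borel_measurable_diff
      simp: has_bochner_integral_iff power2_eq_square elim: eventually_mono)

text \<open>For \<open>s \<le> t\<close> write \<open>B t\<close> as \<open>B s\<close> plus an
  increment orthogonal to \<open>B s\<close>.\<close>

lemma has_bochner_integral_BM_BM:
  assumes "0 \<le> s" "0 \<le> t"
  shows "has_bochner_integral M (\<lambda>\<omega>. B s \<omega> * B t \<omega>) (min s t)"
proof -
  have *: "has_bochner_integral M (\<lambda>\<omega>. B s \<omega> * B t \<omega>) s" if "0 \<le> s" "s \<le> t" for s t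
  proof -
    have "has_bochner_integral M (\<lambda>\<omega>. B s \<omega> * (B t \<omega> - B s \<omega>) + B s \<omega> * B s \<omega>) (0 + s)"
      using that by (intro has_bochner_integral_add has_bochner_integral_BM_square
          has_bochner_integral_past_times_increment[where r=s] measurable_past integrable_BM) auto
    then show ?thesis by (simp add: algebra_simps)
  qed
  show ?thesis
    using *[of s t] *[of t s] assms by (cases "s \<le> t") (auto simp: min_def mult.commute)
qed

text \<open>Expands the product into four covariances. The common value stays behind an existential
  quantifier, so that later arguments can equate the two sides without computing it.\<close>

lemma ito_isometry_interval:
  assumes "0 \<le> a" "a \<le> b" "0 \<le> c" "c \<le> d" "0 \<le> t"
  shows "\<exists>v. has_bochner_integral M (\<lambda>\<omega>. (B (min b t) \<omega> - B (min a t) \<omega>) * (B (min d t) \<omega> - B (min c t) \<omega>)) v \<and>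
    has_bochner_integral lborel (\<lambda>s. indicator {a<..b} s * indicator {c<..d} s * indicator {0..t} s :: real) v"
proof (intro exI conjI)
  let ?v = "max 0 (min (min b d) t - max a c)"
  have "has_bochner_integral M (\<lambda>\<omega>. B (min b t) \<omega> * B (min d t) \<omega> - B (min b t) \<omega> * B (min c t) \<omega>
      - B (min a t) \<omega> * B (min d t) \<omega> + B (min a t) \<omega> * B (min c t) \<omega>)
     (min (min b t) (min d t) - min (min b t) (min c t) - min (min a t) (min d t) + min (min a t) (min c t))"
    using assms by (intro has_bochner_integral_add has_bochner_integral_diff has_bochner_integral_BM_BM) auto
  also have "min (min b t) (min d t) - min (min b t) (min c t) - min (min a t) (min d t) + min (min a t) (min c t) = ?v"
    using assms by (intro min_min_increment)
  finally show "has_bochner_integral M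
      (\<lambda>\<omega>. (B (min b t) \<omega> - B (min a t) \<omega>) * (B (min d t) \<omega> - B (min c t) \<omega>)) ?v"
    by (simp add: algebra_simps)
  have "has_bochner_integral lborel (indicator {max a c<..min (min b d) t} :: real \<Rightarrow> real)
      (measure lborel {max a c<..min (min b d) t})"
    by (intro has_bochner_integral_real_indicator emeasure_bounded_finite) (auto intro: bounded_subset[of "{max a c..min (min b d) t}"])
  moreover have "measure lborel {max a c<..min (min b d) t} = ?v"
    by (auto simp: max_def)
  moreover have "(indicator {max a c<..min (min b d) t} :: real \<Rightarrow> real) =
      (\<lambda>s. indicator {a<..b} s * indicator {c<..d} s * indicator {0..t} s)"
    using assms by (auto simp: fun_eq_iff indicator_def)
  ultimately show "has_bochner_integral lborel
      (\<lambda>s. indicator {a<..b} s * indicator {c<..d} s * indicator {0..t} s :: real) ?v"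
    by simp
qed

text \<open>Both sides are bilinear in the step functions, so nested inductions over the two lists
  reduce the claim to single intervals, which may overlap.\<close>

lemma ito_isometry_steps:
  assumes "valid_steps xs" "valid_steps ys" "0 \<le> t"
  shows "\<exists>v. has_bochner_integral M (\<lambda>\<omega>. step_integral B xs t \<omega> * step_integral B ys t \<omega>) v \<and>
    has_bochner_integral lborel (\<lambda>s. step_fun xs s * step_fun ys s * indicator {0..t} s) v"
  using assms(1)
proof (induction xs)
  case Nil
  then show ?case by (auto intro: has_bochner_integral_zero)
next
  case (Cons x xs)
  obtain a b c where x: "x = (a, b, c)" by (cases x)
  have ab: "0 \<le> a" "a \<le> b" using Cons.prems by (auto simp: x)
  have "\<exists>v. has_bochner_integral M (\<lambda>\<omega>. (B (min b t) \<omega> - B (min a t) \<omega>) * step_integral B ys t \<omega>) v \<and>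
    has_bochner_integral lborel (\<lambda>s. indicator {a<..b} s * step_fun ys s * indicator {0..t} s) v"
    using assms(2)
  proof (induction ys)
    case Nil
    then show ?case by (auto intro: has_bochner_integral_zero)
  next
    case (Cons y ys)
    obtain a' b' c' where y: "y = (a', b', c')" by (cases y)
    obtain v w where v: "has_bochner_integral M (\<lambda>\<omega>. (B (min b t) \<omega> - B (min a t) \<omega>) * step_integral B ys t \<omega>) v"
        "has_bochner_integral lborel (\<lambda>s. indicator {a<..b} s * step_fun ys s * indicator {0..t} s) v"
      and w: "has_bochner_integral M (\<lambda>\<omega>. (B (min b t) \<omega> - B (min a t) \<omega>) * (B (min b' t) \<omega> - B (min a' t) \<omega>)) w"
        "has_bochner_integral lborel (\<lambda>s. indicator {a<..b} s * indicator {a'<..b'} s * indicator {0..t} s) w"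
      using Cons ab ito_isometry_interval[of a b a' b' t] assms(3) unfolding y by auto
    show ?case
      using has_bochner_integral_add[OF has_bochner_integral_mult_right[of c', OF w(1)] v(1)]
        has_bochner_integral_add[OF has_bochner_integral_mult_right[of c', OF w(2)] v(2)]
      by (intro exI[of _ "c' * w + v"]) (auto simp: y algebra_simps)
  qed
  then obtain w where w: "has_bochner_integral M (\<lambda>\<omega>. (B (min b t) \<omega> - B (min a t) \<omega>) * step_integral B ys t \<omega>) w"
    "has_bochner_integral lborel (\<lambda>s. indicator {a<..b} s * step_fun ys s * indicator {0..t} s) w" by blast
  obtain v where v: "has_bochner_integral M (\<lambda>\<omega>. step_integral B xs t \<omega> * step_integral B ys t \<omega>) v"
    "has_bochner_integral lborel (\<lambda>s. step_fun xs s * step_fun ys s * indicator {0..t} s) v"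
    using Cons by (auto simp: x)
  show ?case
    using has_bochner_integral_add[OF has_bochner_integral_mult_right[of c, OF w(1)] v(1)]
      has_bochner_integral_add[OF has_bochner_integral_mult_right[of c, OF w(2)] v(2)]
    by (intro exI[of _ "c * w + v"]) (auto simp: x algebra_simps)
qed

lemma measurable_past_step_integral:
  assumes "valid_steps xs" "0 \<le> s" "s \<le> t"
  shows "step_integral B xs s \<in> borel_measurable (past t)"
  using assms(1)
proof (induction xs)
  case Nil
  have "step_integral B [] s = (\<lambda>_. 0)" by (simp add: fun_eq_iff)
  then show ?case by simp
next
  case (Cons x xs)
  obtain a b c where x: "x = (a, b, c)" by (cases x)
  have "(\<lambda>\<omega>. c * (B (min b s) \<omega> - B (min a s) \<omega>) + step_integral B xs s \<omega>) \<in> borel_measurable (past t)"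
    using Cons assms by (intro borel_measurable_add borel_measurable_times borel_measurable_diff measurable_past) (auto simp: x)
  moreover have "step_integral B (x # xs) s =
      (\<lambda>\<omega>. c * (B (min b s) \<omega> - B (min a s) \<omega>) + step_integral B xs s \<omega>)"
    by (simp add: fun_eq_iff x)
  ultimately show ?case by simp
qed

lemma measurable_step_integral:
  "valid_steps xs \<Longrightarrow> 0 \<le> t \<Longrightarrow> step_integral B xs t \<in> borel_measurable M"
  by (rule measurable_from_past[OF measurable_past_step_integral[of xs t t]]) auto

text \<open>The isometry for the single list \<open>xs @ neg_steps ys\<close>, paired with
  itself.\<close>

lemma nn_integral_step_integral_diff:
  assumes "valid_steps xs" "valid_steps ys" "0 \<le> t"
  shows "(\<integral>\<^sup>+\<omega>. ennreal ((step_integral B xs t \<omega> - step_integral B ys t \<omega>)\<^sup>2) \<partial>M)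
    = L2_err (step_fun xs) (step_fun ys) t"
proof -
  let ?zs = "xs @ neg_steps ys"
  obtain v where v: "has_bochner_integral M (\<lambda>\<omega>. step_integral B ?zs t \<omega> * step_integral B ?zs t \<omega>) v"
    "has_bochner_integral lborel (\<lambda>s. step_fun ?zs s * step_fun ?zs s * indicator {0..t} s) v"
    using ito_isometry_steps[of ?zs ?zs t] assms by auto
  have "(\<integral>\<^sup>+\<omega>. ennreal ((step_integral B xs t \<omega> - step_integral B ys t \<omega>)\<^sup>2) \<partial>M)
      = (\<integral>\<^sup>+\<omega>. ennreal (step_integral B ?zs t \<omega> * step_integral B ?zs t \<omega>) \<partial>M)"
    by (simp add: power2_eq_square)
  also have "\<dots> = ennreal v"
    using v(1) by (subst nn_integral_eq_integral) (auto simp: has_bochner_integral_iff)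
  also have "\<dots> = (\<integral>\<^sup>+s. ennreal (step_fun ?zs s * step_fun ?zs s * indicator {0..t} s) \<partial>lborel)"
    using v(2) by (subst nn_integral_eq_integral) (auto simp: has_bochner_integral_iff)
  also have "\<dots> = L2_err (step_fun xs) (step_fun ys) t"
    unfolding L2_err_def
    by (intro nn_integral_cong) (auto simp: power2_eq_square indicator_def)
  finally show ?thesis .
qed

lemma integrable_step_integral_square:
  assumes "valid_steps xs" "0 \<le> t"
  shows "integrable M (\<lambda>\<omega>. (step_integral B xs t \<omega>)\<^sup>2)"
  using ito_isometry_steps[OF assms(1,1,2)] by (auto simp: power2_eq_square has_bochner_integral_iff)

text \<open>The martingale property of elementary integrals, in a form that avoids conditional
  expectations.\<close>

lemma has_bochner_integral_past_times_step_increment: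
  assumes "valid_steps xs" "0 \<le> s" "s \<le> t" and Z: "Z \<in> borel_measurable (past s)" "integrable M Z"
  shows "has_bochner_integral M (\<lambda>\<omega>. Z \<omega> * (step_integral B xs t \<omega> - step_integral B xs s \<omega>)) (0 :: real)"
  using assms(1)
proof (induction xs)
  case Nil
  then show ?case by (simp add: has_bochner_integral_zero)
next
  case (Cons x xs)
  obtain a b c where x: "x = (a, b, c)" by (cases x)
  have IH: "has_bochner_integral M (\<lambda>\<omega>. Z \<omega> * (step_integral B xs t \<omega> - step_integral B xs s \<omega>)) 0"
    using Cons by (auto simp: x)
  \<comment> \<open>Between the times \<open>s\<close> and \<open>t\<close> the interval
    \<open>{a<..b}\<close> contributes the increment of \<open>B\<close> over its end points clamped
    to \<open>{s..t}\<close>, which starts no earlier than \<open>s\<close>.\<close>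
  have "has_bochner_integral M (\<lambda>\<omega>. Z \<omega> * (B (max s (min b t)) \<omega> - B (max s (min a t)) \<omega>)) 0"
    using Cons.prems assms by (intro has_bochner_integral_past_times_increment[where r=s]) (auto simp: x)
  moreover have "B (max s (min b t)) \<omega> - B (max s (min a t)) \<omega> =
      (B (min b t) \<omega> - B (min a t) \<omega>) - (B (min b s) \<omega> - B (min a s) \<omega>)" for \<omega>
    using Cons.prems assms by (auto simp: x min_def max_def)
  ultimately have "has_bochner_integral M
      (\<lambda>\<omega>. Z \<omega> * ((B (min b t) \<omega> - B (min a t) \<omega>) - (B (min b s) \<omega> - B (min a s) \<omega>))) 0" by simp
  from has_bochner_integral_add[OF has_bochner_integral_mult_right[of c, OF this] IH]
  show ?case by (simp add: x algebra_simps)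
qed

end

subsection \<open>Kolmogorov's maximal inequality and Gaussian laws\<close>

lemma (in prob_space) char_distr_mult:
  assumes [measurable]: "X \<in> borel_measurable M"
  shows "char (distr M borel (\<lambda>\<omega>. c * X \<omega>)) u = char (distr M borel X) (c * u)"
  unfolding char_def by (subst (1 2) integral_distr) (auto simp: ac_simps)

text \<open>Rescaling reduces this to the standard normal law.\<close>

lemma (in prob_space) char_distr_normal:
  assumes "0 < \<sigma>" and X: "distributed M lborel X (\<lambda>x. ennreal (normal_density 0 \<sigma> x))"
  shows "char (distr M borel X) u = of_real (exp (- (\<sigma>\<^sup>2 * u\<^sup>2 / 2)))"
proof -
  have "distributed M lborel (\<lambda>\<omega>. X \<omega> / \<sigma>) std_normal_density"
    using normal_standard_normal_convert[OF \<open>0 < \<sigma>\<close>, of X 0] X by simp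
  then have "distr M lborel (\<lambda>\<omega>. X \<omega> / \<sigma>) = std_normal_distribution"
    by (rule distributed_distr_eq_density)
  then have "distr M borel (\<lambda>\<omega>. X \<omega> / \<sigma>) = std_normal_distribution"
    by (simp cong: distr_cong)
  moreover have "X \<in> borel_measurable M"
    using distributed_measurable[OF X] by simp
  moreover have "X = (\<lambda>\<omega>. \<sigma> * (X \<omega> / \<sigma>))" using \<open>0 < \<sigma>\<close> by auto
  ultimately have "char (distr M borel X) u = char std_normal_distribution (\<sigma> * u)"
    using char_distr_mult[of "\<lambda>\<omega>. X \<omega> / \<sigma>" \<sigma> u] by simp
  then show ?thesis
    by (simp add: char_std_normal_distribution power_mult_distrib)
qed

context brownian_motion
begin

lemma kolmogorov_inequality_finite:
  assumes xs: "valid_steps xs" and F: "finite F" "F \<subseteq> {0..n}" and "0 < l" "0 \<le> n"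
  shows "l\<^sup>2 * prob {\<omega> \<in> space M. \<exists>t\<in>F. l < \<bar>step_integral B xs t \<omega>\<bar>}
    \<le> expectation (\<lambda>\<omega>. (step_integral B xs n \<omega>)\<^sup>2)"
proof -
  let ?S = "step_integral B xs"
  \<comment> \<open>The level is first exceeded at time \<open>t\<close>. Since \<open>A t\<close> belongs to the past of \<open>t\<close>, the martingale
    property makes \<open>1\<^bsub>A t\<^esub> S\<^sub>t\<close> orthogonal to \<open>S\<^sub>n - S\<^sub>t\<close>.\<close>
  define A where "A t = {\<omega> \<in> space M. l < \<bar>?S t \<omega>\<bar> \<and> (\<forall>s\<in>{s\<in>F. s < t}. \<bar>?S s \<omega>\<bar> \<le> l)}" for t
  have A_past: "A t \<in> sets (past t)" if "t \<in> F" for t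
  proof -
    have ev: "{\<omega> \<in> space M. l < \<bar>?S s \<omega>\<bar>} \<in> sets (past t)" if "s \<in> insert t {s\<in>F. s < t}" for s
    proof -
      have [measurable]: "?S s \<in> borel_measurable (past t)"
        using that \<open>t \<in> F\<close> F by (intro measurable_past_step_integral xs) auto
      have "{\<omega> \<in> space (past t). l < \<bar>?S s \<omega>\<bar>} \<in> sets (past t)" by measurable
      then show ?thesis by simp
    qed
    have "{\<omega> \<in> space M. l < \<bar>?S t \<omega>\<bar>} - (\<Union>s\<in>{s\<in>F. s < t}. {\<omega> \<in> space M. l < \<bar>?S s \<omega>\<bar>}) \<in> sets (past t)"
      using F(1) ev by (intro sets.Diff sets.finite_UN) auto
    also have "{\<omega> \<in> space M. l < \<bar>?S t \<omega>\<bar>} - (\<Union>s\<in>{s\<in>F. s < t}. {\<omega> \<in> space M. l < \<bar>?S s \<omega>\<bar>}) = A t"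
      by (force simp: A_def)
    finally show ?thesis .
  qed
  then have A_M [measurable]: "A t \<in> sets M" if "t \<in> F" for t
    using that sets_past_subset by blast
  have disj: "disjoint_family_on A F"
  proof (unfold disjoint_family_on_def, intro ballI impI equals0I)
    fix s t \<omega> assume "s \<in> F" "t \<in> F" "s \<noteq> t" "\<omega> \<in> A s \<inter> A t"
    then show False unfolding A_def by (cases s t rule: linorder_cases) force+
  qed
  have UN: "{\<omega> \<in> space M. \<exists>t\<in>F. l < \<bar>?S t \<omega>\<bar>} = (\<Union>t\<in>F. A t)"
  proof (intro equalityI subsetI)
    fix \<omega> assume \<omega>: "\<omega> \<in> {\<omega> \<in> space M. \<exists>t\<in>F. l < \<bar>?S t \<omega>\<bar>}"
    let ?E = "{t\<in>F. l < \<bar>?S t \<omega>\<bar>}"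
    have "Min ?E \<in> ?E" using \<omega> F by (intro Min_in) auto
    moreover have "\<bar>?S s \<omega>\<bar> \<le> l" if "s \<in> F" "s < Min ?E" for s
      using that F Min_le[of ?E s] by (auto simp: not_le[symmetric])
    ultimately have "\<omega> \<in> A (Min ?E)" using \<omega> by (auto simp: A_def)
    then show "\<omega> \<in> (\<Union>t\<in>F. A t)" using \<open>Min ?E \<in> ?E\<close> by blast
  qed (auto simp: A_def)
  have int_n: "integrable M (\<lambda>\<omega>. (?S n \<omega>)\<^sup>2)"
    using xs \<open>0 \<le> n\<close> by (rule integrable_step_integral_square)
  have meas_n [measurable]: "?S n \<in> borel_measurable M"
    using xs \<open>0 \<le> n\<close> by (rule measurable_step_integral)
  have int_A: "integrable M (\<lambda>\<omega>. indicator (A t) \<omega> * (?S n \<omega>)\<^sup>2)" if "t \<in> F" for t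
    using integrable_mult_indicator[OF A_M[OF that] int_n] by simp
  have main: "l\<^sup>2 * prob (A t) \<le> expectation (\<lambda>\<omega>. indicator (A t) \<omega> * (?S n \<omega>)\<^sup>2)" if "t \<in> F" for t
  proof -
    have t: "0 \<le> t" "t \<le> n" using that F by auto
    have [measurable]: "?S t \<in> borel_measurable (past t)"
      by (rule measurable_past_step_integral[OF xs]) (use t in auto)
    have [measurable]: "A t \<in> sets (past t)" by (rule A_past[OF that])
    have S_t: "?S t \<in> borel_measurable M" by (rule measurable_step_integral[OF xs t(1)])
    have "integrable M (?S t)"
      by (rule square_integrable_imp_integrable[OF S_t integrable_step_integral_square[OF xs t(1)]])
    then have "integrable M (\<lambda>\<omega>. indicator (A t) \<omega> * ?S t \<omega>)"
      using integrable_mult_indicator[OF A_M[OF that], of "?S t"] by simp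
    moreover have "(\<lambda>\<omega>. indicator (A t) \<omega> * ?S t \<omega>) \<in> borel_measurable (past t)" by measurable
    ultimately have mart: "has_bochner_integral M (\<lambda>\<omega>. (indicator (A t) \<omega> * ?S t \<omega>) * (?S n \<omega> - ?S t \<omega>)) 0"
      using xs t by (intro has_bochner_integral_past_times_step_increment)
    have "has_bochner_integral M (\<lambda>\<omega>. l\<^sup>2 * indicator (A t) \<omega> +
        2 * ((indicator (A t) \<omega> * ?S t \<omega>) * (?S n \<omega> - ?S t \<omega>))) (l\<^sup>2 * prob (A t) + 2 * 0)"
      using that by (intro has_bochner_integral_add has_bochner_integral_mult_right mart
          has_bochner_integral_real_indicator) (auto simp: emeasure_eq_measure)
    then have "l\<^sup>2 * prob (A t) = expectation (\<lambda>\<omega>. l\<^sup>2 * indicator (A t) \<omega> +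
        2 * ((indicator (A t) \<omega> * ?S t \<omega>) * (?S n \<omega> - ?S t \<omega>)))"
      and "integrable M (\<lambda>\<omega>. l\<^sup>2 * indicator (A t) \<omega> +
        2 * ((indicator (A t) \<omega> * ?S t \<omega>) * (?S n \<omega> - ?S t \<omega>)))"
      by (simp_all add: has_bochner_integral_iff)
    \<comment> \<open>Expand the square of \<open>?S n \<omega> = ?S t \<omega> + (?S n \<omega> -
      ?S t \<omega>)\<close> and drop the last square; on \<open>A t\<close> the first one is at
      least \<open>l\<^sup>2\<close>.\<close>
    moreover have "l\<^sup>2 * indicator (A t) \<omega> + 2 * ((indicator (A t) \<omega> * ?S t \<omega>) * (?S n \<omega> - ?S t \<omega>))
        \<le> indicator (A t) \<omega> * (?S n \<omega>)\<^sup>2" for \<omega>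
    proof (cases "\<omega> \<in> A t")
      case True
      then have "\<bar>l\<bar> \<le> \<bar>?S t \<omega>\<bar>" using \<open>0 < l\<close> by (simp add: A_def)
      then have "l\<^sup>2 \<le> (?S t \<omega>)\<^sup>2" by (simp only: abs_le_square_iff)
      moreover have "(?S t \<omega>)\<^sup>2 + 2 * (?S t \<omega> * (?S n \<omega> - ?S t \<omega>)) + (?S n \<omega> - ?S t \<omega>)\<^sup>2 = (?S n \<omega>)\<^sup>2"
        by (simp add: power2_eq_square algebra_simps)
      moreover have "0 \<le> (?S n \<omega> - ?S t \<omega>)\<^sup>2" by simp
      ultimately have "l\<^sup>2 + 2 * (?S t \<omega> * (?S n \<omega> - ?S t \<omega>)) \<le> (?S n \<omega>)\<^sup>2" by linarith
      then show ?thesis using True by simp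
    qed simp
    ultimately show ?thesis
      using int_A[OF that] by (auto intro: integral_mono)
  qed
  have "l\<^sup>2 * prob {\<omega> \<in> space M. \<exists>t\<in>F. l < \<bar>?S t \<omega>\<bar>} = (\<Sum>t\<in>F. l\<^sup>2 * prob (A t))"
    unfolding UN using F disj A_M by (subst finite_measure_finite_Union) (auto simp: sum_distrib_left)
  also have "\<dots> \<le> (\<Sum>t\<in>F. expectation (\<lambda>\<omega>. indicator (A t) \<omega> * (?S n \<omega>)\<^sup>2))"
    by (intro sum_mono main)
  also have "\<dots> = expectation (\<lambda>\<omega>. \<Sum>t\<in>F. indicator (A t) \<omega> * (?S n \<omega>)\<^sup>2)"
    using int_A by (simp add: Bochner_Integration.integral_sum)
  also have "\<dots> \<le> expectation (\<lambda>\<omega>. (?S n \<omega>)\<^sup>2)"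
  proof (intro integral_mono int_n Bochner_Integration.integrable_sum int_A)
    fix \<omega>
    have "(\<Sum>t\<in>F. indicator (A t) \<omega> :: real) = indicator (\<Union>t\<in>F. A t) \<omega>"
      using F disj by (simp add: indicator_UN_disjoint)
    also have "\<dots> \<le> 1" by (simp add: indicator_def)
    finally show "(\<Sum>t\<in>F. indicator (A t) \<omega> * (?S n \<omega>)\<^sup>2) \<le> (?S n \<omega>)\<^sup>2"
      by (simp add: sum_distrib_right[symmetric] mult_left_le_one_le sum_nonneg)
  qed
  finally show ?thesis .
qed

text \<open>An enumeration exhausts \<open>F\<close> by finite sets. Their bounds do not depend on
  the set, so continuity of the measure from below passes to the limit.\<close>

lemma kolmogorov_inequality_countable:
  assumes xs: "valid_steps xs" and F: "countable F" "F \<subseteq> {0..n}" and "0 < l" "0 \<le> n"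
  shows "l\<^sup>2 * prob {\<omega> \<in> space M. \<exists>t\<in>F. l < \<bar>step_integral B xs t \<omega>\<bar>}
    \<le> expectation (\<lambda>\<omega>. (step_integral B xs n \<omega>)\<^sup>2)"
proof (cases "F = {}")
  case True
  then show ?thesis by simp
next
  case False
  let ?E = "\<lambda>G. {\<omega> \<in> space M. \<exists>t\<in>G. l < \<bar>step_integral B xs t \<omega>\<bar>}"
  let ?F = "\<lambda>k. from_nat_into F ` {..<k}"
  have F_sub: "?F k \<subseteq> F" for k
    using False by (auto intro: from_nat_into)
  have ev: "?E (?F k) \<in> sets M" for k
  proof -
    have [measurable]: "step_integral B xs t \<in> borel_measurable M" if "t \<in> ?F k" for t
    proof (intro measurable_step_integral xs)
      show "0 \<le> t" using that F F_sub[of k] by (meson atLeastAtMost_iff subset_iff)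
    qed
    show ?thesis
      by (intro sets.sets_Collect_finite_Ex) auto
  qed
  have "(\<lambda>k. prob (?E (?F k))) \<longlonglongrightarrow> prob (\<Union>k. ?E (?F k))"
  proof (rule finite_Lim_measure_incseq)
    show "range (\<lambda>k. ?E (?F k)) \<subseteq> events" using ev by blast
    show "incseq (\<lambda>k. ?E (?F k))" by (force simp: incseq_def)
  qed
  also have "(\<Union>k. ?E (?F k)) = ?E (\<Union>k. ?F k)" by blast
  also have "(\<Union>k. ?F k) = F"
  proof -
    have "(\<Union>k. ?F k) = range (from_nat_into F)" by blast
    then show ?thesis using False F by (simp add: range_from_nat_into)
  qed
  finally have "(\<lambda>k. l\<^sup>2 * prob (?E (?F k))) \<longlonglongrightarrow> l\<^sup>2 * prob (?E F)"
    by (intro tendsto_intros)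
  moreover have "l\<^sup>2 * prob (?E (?F k)) \<le> expectation (\<lambda>\<omega>. (step_integral B xs n \<omega>)\<^sup>2)" for k
    using F F_sub[of k] assms by (intro kolmogorov_inequality_finite) auto
  ultimately show ?thesis by (intro LIMSEQ_le_const2) auto
qed

text \<open>Sharper than measurability with respect to the past of \<open>t\<close>: the sum over
  the first \<open>k\<close> cells is known where the next cell begins, so the next increment is
  independent of it.\<close>

lemma measurable_past_grid_integral:
  assumes "0 \<le> t"
  shows "step_integral B (grid_steps m c k) t \<in> borel_measurable (past (min (real k / real m) t))"
proof (induction k)
  case 0
  have "step_integral B [] t = (\<lambda>_. 0)" by (simp add: fun_eq_iff)
  then show ?case by simp
next
  case (Suc k)
  let ?a = "min (real k / real m) t" and ?b = "min (real (Suc k) / real m) t"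
  have ab: "0 \<le> ?a" "?a \<le> ?b"
    using assms by (simp, intro min.mono divide_right_mono) auto
  have "past_events M B ?a \<subseteq> past_events M B ?b"
    unfolding past_events_def using ab by (intro sigma_sets_mono') force
  then have [measurable]: "step_integral B (grid_steps m c k) t \<in> borel_measurable (past ?b)"
    using Suc unfolding measurable_def sets_past space_past by blast
  have [measurable]: "B ?a \<in> borel_measurable (past ?b)" "B ?b \<in> borel_measurable (past ?b)"
    using ab by (auto intro!: measurable_past simp del: of_nat_Suc)
  have "step_integral B (grid_steps m c (Suc k)) t =
      (\<lambda>\<omega>. step_integral B (grid_steps m c k) t \<omega> + c k * (B ?b \<omega> - B ?a \<omega>))"
    by (simp add: fun_eq_iff)
  moreover have "\<dots> \<in> borel_measurable (past ?b)" by measurable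
  ultimately show ?case by simp
qed

text \<open>Each cell adds an independent centred normal increment, so characteristic functions
  multiply and variances add. In this form the claim includes variance 0 and is stable under
  limits.\<close>

lemma grid_integral_gaussian:
  assumes "0 \<le> t"
  shows "char (distr M borel (step_integral B (grid_steps m c k) t)) u
    = of_real (exp (- (expectation (\<lambda>\<omega>. (step_integral B (grid_steps m c k) t \<omega>)\<^sup>2) * u\<^sup>2 / 2)))"
proof (induction k)
  case 0
  have "step_integral B [] t = (\<lambda>_. 0)" by (simp add: fun_eq_iff)
  then show ?case by (simp add: char_def integral_distr prob_space del: distr_const)
next
  case (Suc k)
  let ?a = "min (real k / real m) t" and ?b = "min (real (Suc k) / real m) t"
  let ?S = "step_integral B (grid_steps m c k) t" and ?X = "\<lambda>\<omega>. c k * (B ?b \<omega> - B ?a \<omega>)"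
  have ab: "0 \<le> ?a" "?a \<le> ?b"
    using assms by (simp, intro min.mono divide_right_mono) auto
  have eq: "step_integral B (grid_steps m c (Suc k)) t = (\<lambda>\<omega>. ?S \<omega> + ?X \<omega>)"
    by (simp add: fun_eq_iff)
  show ?case
  \<comment> \<open>Equality means that the cell begins at or after \<open>t\<close>, or that
    \<open>m = 0\<close> and division by zero puts all grid points at 0. The new increment then
    vanishes.\<close>
  proof (cases "?a = ?b")
    case True
    then show ?thesis using Suc unfolding eq by (simp del: of_nat_Suc)
  next
    case False
    then have pos: "0 < sqrt (?b - ?a)" and less: "?a < ?b" using ab by auto
    have S_past: "?S \<in> borel_measurable (past ?a)"
      by (rule measurable_past_grid_integral[OF assms])
    have "indep_var borel ?S borel (\<lambda>\<omega>. B ?b \<omega> - B ?a \<omega>)"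
      by (rule indep_past_increment[OF ab(1) less S_past])
    from indep_var_compose[OF this, of id borel "\<lambda>x. c k * x" borel]
    have "indep_var borel ?S borel ?X" by (simp add: o_def id_def)
    then have char: "char (distr M borel (\<lambda>\<omega>. ?S \<omega> + ?X \<omega>)) u
        = char (distr M borel ?S) u * char (distr M borel ?X) u"
      by (rule char_distr_add)
    have [measurable]: "B ?a \<in> borel_measurable M" "B ?b \<in> borel_measurable M"
      using ab by (auto intro!: measurable_BM simp del: of_nat_Suc)
    have "char (distr M borel ?X) u = char (distr M borel (\<lambda>\<omega>. B ?b \<omega> - B ?a \<omega>)) (c k * u)"
      by (rule char_distr_mult) measurable
    also have "\<dots> = of_real (exp (- ((sqrt (?b - ?a))\<^sup>2 * (c k * u)\<^sup>2 / 2)))"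
      by (intro char_distr_normal normal_increments_BM pos less ab)
    finally have char_X: "char (distr M borel ?X) u = of_real (exp (- ((c k)\<^sup>2 * (?b - ?a) * u\<^sup>2 / 2)))"
      using ab by (simp add: power_mult_distrib ac_simps del: of_nat_Suc)
    have sq: "integrable M (\<lambda>\<omega>. (?S \<omega>)\<^sup>2)"
      by (intro integrable_step_integral_square assms) simp
    have "?S \<in> borel_measurable M" by (intro measurable_step_integral assms) simp
    then have "integrable M ?S" using sq by (rule square_integrable_imp_integrable)
    \<comment> \<open>The cross term has mean 0, so the second moment grows by that of the new
      increment alone.\<close>
    then have "has_bochner_integral M (\<lambda>\<omega>. ?S \<omega> * (B ?b \<omega> - B ?a \<omega>)) 0"
      by (intro has_bochner_integral_past_times_increment[where r="?a"] S_past ab) auto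
    moreover have "has_bochner_integral M (\<lambda>\<omega>. (B ?b \<omega> - B ?a \<omega>)\<^sup>2) (?b - ?a)"
      using ab by (auto simp: has_bochner_integral_iff simp del: of_nat_Suc
          intro!: integrable_increment_square expectation_increment_square)
    moreover have "has_bochner_integral M (\<lambda>\<omega>. (?S \<omega>)\<^sup>2) (expectation (\<lambda>\<omega>. (?S \<omega>)\<^sup>2))"
      using sq by (simp add: has_bochner_integral_iff)
    ultimately have "has_bochner_integral M (\<lambda>\<omega>. (?S \<omega>)\<^sup>2 + 2 * c k * (?S \<omega> * (B ?b \<omega> - B ?a \<omega>))
        + (c k)\<^sup>2 * (B ?b \<omega> - B ?a \<omega>)\<^sup>2) (expectation (\<lambda>\<omega>. (?S \<omega>)\<^sup>2) + 2 * c k * 0 + (c k)\<^sup>2 * (?b - ?a))"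
      by (intro has_bochner_integral_add has_bochner_integral_mult_right)
    moreover have "(?S \<omega>)\<^sup>2 + 2 * c k * (?S \<omega> * (B ?b \<omega> - B ?a \<omega>)) + (c k)\<^sup>2 * (B ?b \<omega> - B ?a \<omega>)\<^sup>2
        = (?S \<omega> + ?X \<omega>)\<^sup>2" for \<omega>
      by (simp add: power2_eq_square algebra_simps)
    ultimately have E: "expectation (\<lambda>\<omega>. (?S \<omega> + ?X \<omega>)\<^sup>2)
        = expectation (\<lambda>\<omega>. (?S \<omega>)\<^sup>2) + (c k)\<^sup>2 * (?b - ?a)"
      by (simp add: has_bochner_integral_iff)
    have "exp (- ((e + q) * u\<^sup>2 / 2)) = exp (- (e * u\<^sup>2 / 2)) * exp (- (q * u\<^sup>2 / 2))" for e q :: real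
      by (simp add: mult_exp_exp distrib_right add_divide_distrib)
    then show ?thesis
      unfolding eq char Suc char_X E by simp
  qed
qed

end

subsection \<open>The Wiener integral as a continuous process\<close>

text \<open>Approximation from below keeps the rational points inside the interval, and the left end
  point 0 is itself rational.\<close>

lemma closure_rationals_interval:
  assumes "0 \<le> (n :: real)"
  shows "{0..n} \<subseteq> closure (\<rat> \<inter> {0..n})"
proof
  fix x assume x: "x \<in> {0..n}"
  show "x \<in> closure (\<rat> \<inter> {0..n})"
  proof (cases "x = 0")
    case True
    then show ?thesis using assms closure_subset by fastforce
  next
    case False
    show ?thesis unfolding closure_approachable
    proof safe
      fix e :: real assume "0 < e"
      then obtain q where "q \<in> \<rat>" "max 0 (x - e) < q" "q < x"
        using Rats_dense_in_real[of "max 0 (x - e)" x] x False by auto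
      then show "\<exists>q\<in>\<rat> \<inter> {0..n}. dist q x < e"
        using x by (intro bexI[of _ q]) (auto simp: dist_real_def)
    qed
  qed
qed

lemma continuous_on_atLeast_0I:
  fixes f :: "real \<Rightarrow> real"
  assumes "\<And>n::nat. continuous_on {0..real n} f"
  shows "continuous_on {0..} f"
  unfolding continuous_on_def
proof
  fix t :: real assume t: "t \<in> {0..}"
  obtain n :: nat where n: "t + 1 < real n" using reals_Archimedean2 by blast
  have "at t within {0..} = at t within {0..real n}"
    using n by (intro at_within_nhd[of t "{..<t + 1}"]) auto
  then show "(f \<longlongrightarrow> f t) (at t within {0..})"
    using assms[of n] t n by (auto simp: continuous_on_def)
qed

lemma (in prob_space) char_distr_tendsto:
  assumes [measurable]: "\<And>n. X n \<in> borel_measurable M" "Y \<in> borel_measurable M"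
    and lim: "AE \<omega> in M. (\<lambda>n::nat. X n \<omega>) \<longlonglongrightarrow> Y \<omega>"
  shows "(\<lambda>n. char (distr M borel (X n)) u) \<longlonglongrightarrow> char (distr M borel Y) u"
proof -
  have "(\<lambda>n. \<integral>\<omega>. iexp (u * X n \<omega>) \<partial>M) \<longlonglongrightarrow> (\<integral>\<omega>. iexp (u * Y \<omega>) \<partial>M)"
  proof (rule integral_dominated_convergence[where w="\<lambda>_. 1"])
    show "AE \<omega> in M. (\<lambda>n. iexp (u * X n \<omega>)) \<longlonglongrightarrow> iexp (u * Y \<omega>)"
      using lim by eventually_elim (intro tendsto_intros)
  qed auto
  then show ?thesis
    unfolding char_def by (simp add: integral_distr)
qed

text \<open>The rate 8^-n serves two later estimates: divided by the squared level 4^-n of the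
  maximal inequality, or multiplied by the weight 4^n in the variance bound, it still leaves
  2^-n.\<close>

lemma grid_approximation:
  assumes b: "b \<in> borel_measurable borel" "\<And>t. 0 \<le> t \<Longrightarrow> (\<integral>\<^sup>+s\<in>{0..t}. ennreal ((b s)\<^sup>2) \<partial>lborel) < \<infinity>"
  obtains m c k where "\<And>n. L2_err (step_fun (grid_steps (m n) (c n) (k n))) b (real n) \<le> ennreal ((1/8) ^ n)"
proof -
  have "\<forall>n. \<exists>m c k. L2_err (step_fun (grid_steps m c k)) b (real n) \<le> ennreal ((1/8) ^ n)"
    using step_approximable_L2[of b] b unfolding step_approximable_def by simp
  then show ?thesis using that by metis
qed

context brownian_motion
begin

lemma step_integral_0: "valid_steps xs \<Longrightarrow> step_integral B xs 0 \<omega> = 0"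
  by (induction xs) (auto simp: min_absorb2)

lemma continuous_on_step_integral:
  assumes "continuous_on {0..} (\<lambda>t. B t \<omega>)" "valid_steps xs"
  shows "continuous_on {0..} (\<lambda>t. step_integral B xs t \<omega>)"
  using assms(2)
proof (induction xs)
  case (Cons x xs)
  obtain a b c where x: "x = (a, b, c)" by (cases x)
  have "continuous_on {0..} (\<lambda>t. B (min r t) \<omega>)" if "0 \<le> r" for r
    using that by (intro continuous_on_compose2[OF assms(1)] continuous_intros) auto
  then show ?case using Cons by (auto simp: x intro!: continuous_intros)
qed simp

text \<open>At level 2^-n the maximal inequality gives exceptional events of summable probability,
  so almost surely only finitely many of them occur. The factor 4 comes from the triangle inequality
  for \<open>L2_err\<close>.\<close>

lemma AE_uniformly_Cauchy_steps:
  assumes xs: "\<And>n. valid_steps (xs n)"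
    and err: "\<And>n. L2_err (step_fun (xs (Suc n))) (step_fun (xs n)) (real n) \<le> ennreal (4 * (1/8) ^ n)"
  shows "AE \<omega> in M. \<forall>\<^sub>F n in sequentially. \<forall>t\<in>{0..real n}.
    \<bar>step_integral B (xs (Suc n)) t \<omega> - step_integral B (xs n) t \<omega>\<bar> \<le> (1/2) ^ n"
proof -
  define ys where "ys n = xs (Suc n) @ neg_steps (xs n)" for n
  have ys: "valid_steps (ys n)" for n using xs by (simp add: ys_def)
  let ?D = "\<lambda>n. step_integral B (ys n)"
  \<comment> \<open>Restricting to rational times keeps the event measurable; continuity of the
    paths extends the bound to all times.\<close>
  define E where "E n = {\<omega> \<in> space M. \<exists>t\<in>\<rat> \<inter> {0..real n}. (1/2) ^ n < \<bar>?D n t \<omega>\<bar>}" for n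
  have E_M: "E n \<in> sets M" for n
  proof -
    have "{\<omega> \<in> space M. (1/2) ^ n < \<bar>?D n t \<omega>\<bar>} \<in> sets M" if "t \<in> \<rat> \<inter> {0..real n}" for t
    proof -
      have [measurable]: "?D n t \<in> borel_measurable M"
        using that by (intro measurable_step_integral ys) auto
      show ?thesis by measurable
    qed
    then have "(\<Union>t\<in>\<rat> \<inter> {0..real n}. {\<omega> \<in> space M. (1/2) ^ n < \<bar>?D n t \<omega>\<bar>}) \<in> sets M"
      by (intro sets.countable_UN'' countable_Int1 countable_rat)
    also have "(\<Union>t\<in>\<rat> \<inter> {0..real n}. {\<omega> \<in> space M. (1/2) ^ n < \<bar>?D n t \<omega>\<bar>}) = E n"
      by (auto simp: E_def)
    finally show ?thesis .
  qed
  have prob_E: "prob (E n) \<le> 4 * (1/2) ^ n" for n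
  proof -
    have "ennreal (expectation (\<lambda>\<omega>. (?D n (real n) \<omega>)\<^sup>2)) = (\<integral>\<^sup>+\<omega>. ennreal ((?D n (real n) \<omega>)\<^sup>2) \<partial>M)"
      using integrable_step_integral_square[OF ys, of "real n" n] by (subst nn_integral_eq_integral) auto
    also have "\<dots> = L2_err (step_fun (xs (Suc n))) (step_fun (xs n)) (real n)"
      using nn_integral_step_integral_diff[OF xs xs, of "real n" "Suc n" n] by (simp add: ys_def)
    also have "\<dots> \<le> ennreal (4 * (1/8) ^ n)" by (rule err)
    finally have "expectation (\<lambda>\<omega>. (?D n (real n) \<omega>)\<^sup>2) \<le> 4 * (1/8) ^ n"
      by (simp add: ennreal_le_iff)
    moreover have "((1/2) ^ n)\<^sup>2 * prob (E n) \<le> expectation (\<lambda>\<omega>. (?D n (real n) \<omega>)\<^sup>2)"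
      unfolding E_def by (intro kolmogorov_inequality_countable ys countable_Int1 countable_rat) auto
    ultimately have "((1/2) ^ n)\<^sup>2 * prob (E n) \<le> 4 * (1/8) ^ n" by linarith
    also have "((1/2 :: real) ^ n)\<^sup>2 = (1/4) ^ n"
      by (simp add: power2_eq_square flip: power_mult_distrib)
    also have "4 * (1/8 :: real) ^ n = (1/4) ^ n * (4 * (1/2) ^ n)"
      by (simp flip: power_mult_distrib)
    finally have "(1/4) ^ n * prob (E n) \<le> (1/4) ^ n * (4 * (1/2) ^ n)" .
    then show ?thesis by (rule mult_left_le_imp_le) simp
  qed
  have "summable (\<lambda>n. prob (E n))"
    by (rule summable_comparison_test'[OF summable_mult[OF summable_geometric[of "1/2 :: real"]], of 0 _ 4])
      (use prob_E in auto)
  then have "AE \<omega> in M. \<forall>\<^sub>F n in sequentially. \<omega> \<in> space M - E n"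
    using E_M by (intro borel_cantelli_AE1) (auto simp: emeasure_eq_measure)
  with continuous_BM show ?thesis
  proof eventually_elim
    case (elim \<omega>)
    from elim(2) show ?case
    proof eventually_elim
      case (elim n)
      show ?case
      proof
        fix t assume t: "t \<in> {0..real n}"
        have "\<bar>?D n t \<omega>\<bar> \<le> (1/2) ^ n"
        proof (rule continuous_le_on_closure[of "\<rat> \<inter> {0..real n}" "\<lambda>t. \<bar>?D n t \<omega>\<bar>"])
          have "closure (\<rat> \<inter> {0..real n}) \<subseteq> {0..real n}"
            by (rule closure_minimal) auto
          then show "continuous_on (closure (\<rat> \<inter> {0..real n})) (\<lambda>t. \<bar>?D n t \<omega>\<bar>)"
            by (intro continuous_intros continuous_on_subset[OF continuous_on_step_integral[OF _ ys]])
              (use \<open>continuous_on {0..} (\<lambda>t. B t \<omega>)\<close> in auto)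
          show "t \<in> closure (\<rat> \<inter> {0..real n})"
            using closure_rationals_interval[of "real n"] t by auto
        qed (use elim in \<open>auto simp: E_def not_less\<close>)
        then show "\<bar>step_integral B (xs (Suc n)) t \<omega> - step_integral B (xs n) t \<omega>\<bar> \<le> (1/2) ^ n"
          by (simp add: ys_def)
      qed
    qed
  qed
qed

text \<open>The sequence is a telescoping series dominated by a geometric one from some index on.
  The Weierstrass test gives uniform convergence on each \<open>{0..real N}\<close>, hence
  continuous limit paths.\<close>

lemma AE_step_integral_limit:
  assumes xs: "\<And>n. valid_steps (xs n)"
    and err: "\<And>n. L2_err (step_fun (xs (Suc n))) (step_fun (xs n)) (real n) \<le> ennreal (4 * (1/8) ^ n)"
  shows "AE \<omega> in M. continuous_on {0..} (\<lambda>t. lim (\<lambda>n. step_integral B (xs n) t \<omega>)) \<and>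
    (\<forall>t\<ge>0. convergent (\<lambda>n. step_integral B (xs n) t \<omega>))"
  using AE_uniformly_Cauchy_steps[OF assms] continuous_BM
proof eventually_elim
  case (elim \<omega>)
  let ?S = "\<lambda>n t. step_integral B (xs n) t \<omega>"
  have unif: "uniform_limit {0..real N} ?S (\<lambda>t. lim (\<lambda>n. ?S n t)) sequentially" for N
  proof -
    have "\<forall>\<^sub>F n in sequentially. \<forall>t\<in>{0..real N}. norm (?S (Suc n) t - ?S n t) \<le> (1/2) ^ n"
      using elim(1) eventually_ge_at_top[of N] by eventually_elim auto
    then have "uniformly_convergent_on {0..real N} (\<lambda>n t. \<Sum>i<n. ?S (Suc i) t - ?S i t)"
      by (rule Weierstrass_m_test'_ev) (auto intro: summable_geometric)
    then have "uniformly_convergent_on {0..real N} (\<lambda>n t. ?S 0 t + (\<Sum>i<n. ?S (Suc i) t - ?S i t))"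
      by (intro uniformly_convergent_add uniformly_convergent_on_const[of _ "?S 0"])
    moreover have "(\<Sum>i<n. ?S (Suc i) t - ?S i t) = ?S n t - ?S 0 t" for n t
      by (rule sum_lessThan_telescope)
    ultimately have "uniformly_convergent_on {0..real N} ?S" by simp
    then show ?thesis by (simp add: uniformly_convergent_uniform_limit_iff)
  qed
  show ?case
  proof (intro conjI allI impI continuous_on_atLeast_0I)
    fix N :: nat
    show "continuous_on {0..real N} (\<lambda>t. lim (\<lambda>n. ?S n t))"
      by (rule uniform_limit_theorem[OF always_eventually unif])
        (auto intro: continuous_on_subset[OF continuous_on_step_integral[OF elim(2) xs]])
  next
    fix t :: real assume "0 \<le> t"
    moreover obtain N :: nat where "t \<le> real N" using real_arch_simple by blast
    ultimately show "convergent (\<lambda>n. ?S n t)"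
      using tendsto_uniform_limitI[OF unif, of t N] by (auto simp: convergent_def)
  qed
qed

text \<open>By the isometry the variances are the squared norms of the step functions on
  \<open>{0..t}\<close>, which converge to that of \<open>b\<close>.\<close>

lemma step_integral_variance_tendsto:
  assumes xs: "\<And>n. valid_steps (xs n)" and "0 \<le> t"
    and b [measurable]: "b \<in> borel_measurable borel"
    and fin: "(\<integral>\<^sup>+s\<in>{0..t}. ennreal ((b s)\<^sup>2) \<partial>lborel) < \<infinity>"
    and err: "\<forall>\<^sub>F n in sequentially. L2_err (step_fun (xs n)) b t \<le> ennreal ((1/8) ^ n)"
  shows "(\<lambda>n. expectation (\<lambda>\<omega>. (step_integral B (xs n) t \<omega>)\<^sup>2)) \<longlonglongrightarrow> (LINT s:{0..t}|lborel. (b s)\<^sup>2)"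
proof -
  let ?v = "\<lambda>n. expectation (\<lambda>\<omega>. (step_integral B (xs n) t \<omega>)\<^sup>2)"
  let ?H = "LINT s:{0..t}|lborel. (b s)\<^sup>2"
  let ?b = "\<lambda>s. (b s)\<^sup>2 * indicator {0..t} s"
  have H: "?H = (LINT s|lborel. ?b s)"
    by (simp add: set_lebesgue_integral_def mult.commute)
  have int_b: "integrable lborel ?b"
  proof (rule integrableI_nonneg)
    have "(\<integral>\<^sup>+s. ennreal (?b s) \<partial>lborel) = (\<integral>\<^sup>+s\<in>{0..t}. ennreal ((b s)\<^sup>2) \<partial>lborel)"
      by (intro nn_integral_cong) (auto simp: indicator_def)
    then show "(\<integral>\<^sup>+s. ennreal (?b s) \<partial>lborel) < \<infinity>" using fin by simp
  qed auto
  have "\<forall>\<^sub>F n in sequentially. \<bar>?v n - ?H\<bar> \<le> (1/8) ^ n + (1/2) ^ n + (1/4) ^ n * ?H"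
    using err
  proof eventually_elim
    case (elim n)
    let ?f = "step_fun (xs n)" and ?r = "2 ^ n :: real"
    let ?e = "\<lambda>s. (?f s - b s)\<^sup>2 * indicator {0..t} s"
    obtain v where v: "has_bochner_integral M (\<lambda>\<omega>. step_integral B (xs n) t \<omega> * step_integral B (xs n) t \<omega>) v"
      "has_bochner_integral lborel (\<lambda>s. ?f s * ?f s * indicator {0..t} s) v"
      using ito_isometry_steps[OF xs xs \<open>0 \<le> t\<close>] by blast
    have int_f: "integrable lborel (\<lambda>s. (?f s)\<^sup>2 * indicator {0..t} s)"
      and eq_f: "?v n = (LINT s|lborel. (?f s)\<^sup>2 * indicator {0..t} s)"
      using v by (simp_all add: has_bochner_integral_iff power2_eq_square)
    have nn_e: "(\<integral>\<^sup>+s. ennreal (?e s) \<partial>lborel) = L2_err ?f b t"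
      unfolding L2_err_def by (intro nn_integral_cong) (auto simp: indicator_def)
    have int_e: "integrable lborel ?e"
      using elim by (intro integrableI_nonneg) (auto simp: nn_e intro: le_less_trans)
    have "ennreal (LINT s|lborel. ?e s) \<le> ennreal ((1/8) ^ n)"
      using elim int_e by (subst nn_integral_eq_integral[symmetric]) (auto simp: nn_e)
    then have e: "(LINT s|lborel. ?e s) \<le> (1/8) ^ n" by simp
    \<comment> \<open>With \<open>d = ?f s - b s\<close>, the cross term
      \<open>2 * (b s * d)\<close> is split by Young's inequality with weight \<open>4 ^ n\<close>:
      large enough to make the \<open>b\<close> part vanish, yet small against the error
      8^-n.\<close>
    have bound: "\<bar>(?f s)\<^sup>2 * indicator {0..t} s - ?b s\<bar> \<le> (1 + 4 ^ n) * ?e s + (1/4) ^ n * ?b s" for s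
    proof -
      define d where "d = ?f s - b s"
      have r: "?r\<^sup>2 = 4 ^ n" "(1 / ?r)\<^sup>2 = (1/4) ^ n" "?r * (1 / ?r) = 1"
        by (simp_all add: power2_eq_square power_divide flip: power_mult_distrib)
      have "0 \<le> (?r * d + (1 / ?r) * b s)\<^sup>2" "0 \<le> (?r * d - (1 / ?r) * b s)\<^sup>2" by auto
      moreover have "(?r * d + (1 / ?r) * b s)\<^sup>2 = ?r\<^sup>2 * d\<^sup>2 + (1 / ?r)\<^sup>2 * (b s)\<^sup>2 + 2 * (?r * (1 / ?r)) * (b s * d)"
        "(?r * d - (1 / ?r) * b s)\<^sup>2 = ?r\<^sup>2 * d\<^sup>2 + (1 / ?r)\<^sup>2 * (b s)\<^sup>2 - 2 * (?r * (1 / ?r)) * (b s * d)"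
        by (simp_all only: power2_eq_square algebra_simps) simp_all
      ultimately have "\<bar>2 * (b s * d)\<bar> \<le> 4 ^ n * d\<^sup>2 + (1/4) ^ n * (b s)\<^sup>2"
        unfolding r by linarith
      moreover have "(?f s)\<^sup>2 - (b s)\<^sup>2 = d\<^sup>2 + 2 * (b s * d)"
        by (simp add: d_def power2_eq_square algebra_simps)
      moreover have "0 \<le> d\<^sup>2" by simp
      ultimately have "\<bar>(?f s)\<^sup>2 - (b s)\<^sup>2\<bar> \<le> d\<^sup>2 + 4 ^ n * d\<^sup>2 + (1/4) ^ n * (b s)\<^sup>2" by linarith
      then show ?thesis by (simp add: d_def indicator_def distrib_right)
    qed
    have "\<bar>?v n - ?H\<bar> = \<bar>LINT s|lborel. (?f s)\<^sup>2 * indicator {0..t} s - ?b s\<bar>"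
      unfolding H eq_f using int_f int_b by simp
    also have "\<dots> \<le> (LINT s|lborel. (1 + 4 ^ n) * ?e s + (1/4) ^ n * ?b s)"
      using int_f int_b int_e bound
      by (intro order_trans[OF integral_abs_bound] integral_mono) auto
    also have "\<dots> = (1 + 4 ^ n) * (LINT s|lborel. ?e s) + (1/4) ^ n * ?H"
      unfolding H using int_b int_e by simp
    also have "\<dots> \<le> (1 + 4 ^ n) * (1/8) ^ n + (1/4) ^ n * ?H"
      using e by (intro add_right_mono mult_left_mono) auto
    also have "(1 + 4 ^ n) * (1/8) ^ n = (1/8) ^ n + (1/2 :: real) ^ n"
      by (simp add: distrib_right flip: power_mult_distrib)
    finally show ?case .
  qed
  moreover have "(\<lambda>n. (1/8) ^ n + (1/2) ^ n + (1/4) ^ n * ?H) \<longlonglongrightarrow> 0 + 0 + 0 * ?H"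
    by (intro tendsto_intros LIMSEQ_power_zero) auto
  ultimately have "(\<lambda>n. ?v n - ?H) \<longlonglongrightarrow> 0"
    by (intro Lim_null_comparison[where f="\<lambda>n. ?v n - ?H"]) auto
  then show ?thesis by (simp add: LIM_zero_iff)
qed

text \<open>The almost sure limit of grid integrals, set to 0 on a null set because
  \<open>is_stochastic_integral\<close> demands continuity of every path. The Gaussian
  characteristic functions pass to the limit.\<close>

lemma wiener_integral_exists:
  assumes b [measurable]: "b \<in> borel_measurable borel"
    and fin: "\<And>t. 0 \<le> t \<Longrightarrow> (\<integral>\<^sup>+s\<in>{0..t}. ennreal ((b s)\<^sup>2) \<partial>lborel) < \<infinity>"
  shows "\<exists>I. is_stochastic_integral M b B I \<and> (\<forall>\<omega>. I 0 \<omega> = 0) \<and>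
    (\<forall>t\<ge>0. \<forall>u. char (distr M borel (I t)) u
      = of_real (exp (- ((LINT s:{0..t}|lborel. (b s)\<^sup>2) * u\<^sup>2 / 2))))"
proof -
  obtain m c k where approx:
    "\<And>n. L2_err (step_fun (grid_steps (m n) (c n) (k n))) b (real n) \<le> ennreal ((1/8) ^ n)"
    using grid_approximation[OF b fin] by blast
  define xs where "xs n = grid_steps (m n) (c n) (k n)" for n
  have xs: "valid_steps (xs n)" for n by (simp add: xs_def)
  have err: "L2_err (step_fun (xs n)) b t \<le> ennreal ((1/8) ^ n)" if "t \<le> real n" for n t
    using order_trans[OF L2_err_mono[OF that] approx[of n]] by (simp add: xs_def)
  have err2: "L2_err (step_fun (xs n')) (step_fun (xs n)) t \<le> ennreal (4 * (1/8) ^ n)"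
    if "t \<le> real n" "n \<le> n'" for n n' t
  proof -
    have "L2_err (step_fun (xs n')) (step_fun (xs n)) t
        \<le> 2 * L2_err (step_fun (xs n')) b t + 2 * L2_err b (step_fun (xs n)) t"
      by (rule L2_err_triangle) auto
    also have "\<dots> \<le> 2 * ennreal ((1/8) ^ n') + 2 * ennreal ((1/8) ^ n)"
      using that by (intro add_mono mult_left_mono err L2_err_commute[THEN ord_eq_le_trans]) auto
    also have "\<dots> \<le> 2 * ennreal ((1/8) ^ n) + 2 * ennreal ((1/8) ^ n)"
      using that by (intro add_mono mult_left_mono ennreal_leI power_decreasing) auto
    also have "\<dots> = ennreal (4 * (1/8) ^ n)"
      by (simp flip: ennreal_numeral ennreal_mult' ennreal_plus)
    finally show ?thesis .
  qed
  let ?S = "\<lambda>n t \<omega>. step_integral B (xs n) t \<omega>"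
  obtain N where N: "N \<in> null_sets M"
    and good: "\<And>\<omega>. \<omega> \<in> space M - N \<Longrightarrow> continuous_on {0..} (\<lambda>t. lim (\<lambda>n. ?S n t \<omega>)) \<and>
      (\<forall>t\<ge>0. convergent (\<lambda>n. ?S n t \<omega>))"
    using AE_step_integral_limit[of xs, OF xs err2] by (auto elim!: AE_E3)
  define I where "I t \<omega> = (if \<omega> \<in> N then 0 else lim (\<lambda>n. ?S n t \<omega>))" for t \<omega>
  have N_sets [measurable]: "N \<in> sets M" using N by auto
  have S_meas: "?S n t \<in> borel_measurable M" if "0 \<le> t" for n t
    by (rule measurable_step_integral[OF xs that])
  have I_meas: "I t \<in> borel_measurable M" if "0 \<le> t" for t
  proof -
    have [measurable]: "?S n t \<in> borel_measurable M" for n by (rule S_meas[OF that])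
    show ?thesis unfolding I_def by measurable
  qed
  have lim: "AE \<omega> in M. (\<lambda>n. ?S n t \<omega>) \<longlonglongrightarrow> I t \<omega>" if "0 \<le> t" for t
    using AE_not_in[OF N] AE_space
  proof eventually_elim
    case (elim \<omega>)
    then have "convergent (\<lambda>n. ?S n t \<omega>)" using good[of \<omega>] that by auto
    then show ?case using elim by (simp add: I_def convergent_LIMSEQ_iff)
  qed
  show ?thesis
  proof (intro exI[of _ I] conjI allI impI)
    show "is_stochastic_integral M b B I"
      unfolding is_stochastic_integral_def
    proof (intro conjI allI impI ballI)
      fix \<omega> assume "\<omega> \<in> space M"
      then show "continuous_on {0..} (\<lambda>t. I t \<omega>)"
        using good[of \<omega>] by (cases "\<omega> \<in> N") (auto simp: I_def)
    next
      fix t :: real assume t: "0 \<le> t"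
      have late: "\<forall>\<^sub>F n in sequentially. t \<le> real n"
        using eventually_ge_at_top[of "nat \<lceil>t\<rceil>"] by eventually_elim (simp add: nat_le_iff ceiling_le_iff)
      have small: "(\<lambda>n. ennreal (r * (1/8) ^ n)) \<longlonglongrightarrow> 0" for r
      proof -
        have "(\<lambda>n. ennreal (r * (1/8) ^ n)) \<longlonglongrightarrow> ennreal (r * 0)"
          by (intro tendsto_intros LIMSEQ_power_zero) auto
        then show ?thesis by simp
      qed
      have "(\<lambda>n. L2_err (step_fun (xs n)) b t) \<longlonglongrightarrow> 0"
        using late by (intro tendsto_sandwich[OF _ _ tendsto_const small[of 1]])
          (auto elim!: eventually_mono intro: err)
      \<comment> \<open>Fatou's lemma: the isometry bounds the distance from \<open>?S n t\<close>
        to all later approximants, and the almost sure limit inherits the bound.\<close>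
      moreover have "(\<integral>\<^sup>+\<omega>. ennreal ((?S n t \<omega> - I t \<omega>)\<^sup>2) \<partial>M) \<le> ennreal (4 * (1/8) ^ n)"
        if n: "t \<le> real n" for n
      proof -
        have [measurable]: "?S n t \<in> borel_measurable M" for n by (rule S_meas[OF t])
        have "(\<integral>\<^sup>+\<omega>. ennreal ((?S n t \<omega> - I t \<omega>)\<^sup>2) \<partial>M)
            = (\<integral>\<^sup>+\<omega>. liminf (\<lambda>n'. ennreal ((?S n t \<omega> - ?S n' t \<omega>)\<^sup>2)) \<partial>M)"
        proof (intro nn_integral_cong_AE, use lim[OF t] in eventually_elim)
          case (elim \<omega>)
          then have "(\<lambda>n'. ennreal ((?S n t \<omega> - ?S n' t \<omega>)\<^sup>2)) \<longlonglongrightarrow> ennreal ((?S n t \<omega> - I t \<omega>)\<^sup>2)"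
            by (intro tendsto_intros)
          then show ?case by (intro lim_imp_Liminf[symmetric]) auto
        qed
        also have "\<dots> \<le> liminf (\<lambda>n'. \<integral>\<^sup>+\<omega>. ennreal ((?S n t \<omega> - ?S n' t \<omega>)\<^sup>2) \<partial>M)"
          by (intro nn_integral_liminf) measurable
        also have "\<dots> = liminf (\<lambda>n'. L2_err (step_fun (xs n')) (step_fun (xs n)) t)"
          using t by (simp add: nn_integral_step_integral_diff xs L2_err_commute)
        also have "\<dots> \<le> ennreal (4 * (1/8) ^ n)"
          by (intro Liminf_le eventually_mono[OF eventually_ge_at_top[of n]] err2 n) auto
        finally show ?thesis .
      qed
      then have "(\<lambda>n. \<integral>\<^sup>+\<omega>. ennreal ((?S n t \<omega> - I t \<omega>)\<^sup>2) \<partial>M) \<longlonglongrightarrow> 0"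
        using late by (intro tendsto_sandwich[OF _ _ tendsto_const small[of 4]])
          (auto elim!: eventually_mono)
      ultimately show "\<exists>xs. (\<forall>n. valid_steps (xs n)) \<and>
          (\<lambda>n. \<integral>\<^sup>+s\<in>{0..t}. ennreal ((step_fun (xs n) s - b s)\<^sup>2) \<partial>lborel) \<longlonglongrightarrow> 0 \<and>
          (\<lambda>n::nat. \<integral>\<^sup>+\<omega>. ennreal ((step_integral B (xs n) t \<omega> - I t \<omega>)\<^sup>2) \<partial>M) \<longlonglongrightarrow> 0"
        using xs by (intro exI[of _ xs]) (simp add: L2_err_def)
    qed (rule I_meas)
  next
    show "I 0 \<omega> = 0" for \<omega>
      by (simp add: I_def step_integral_0 xs)
  next
    fix t u :: real assume t: "0 \<le> t"
    let ?H = "LINT s:{0..t}|lborel. (b s)\<^sup>2"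
    have late: "\<forall>\<^sub>F n in sequentially. t \<le> real n"
      using eventually_ge_at_top[of "nat \<lceil>t\<rceil>"] by eventually_elim (simp add: nat_le_iff ceiling_le_iff)
    have "(\<lambda>n. char (distr M borel (?S n t)) u) \<longlonglongrightarrow> char (distr M borel (I t)) u"
      by (intro char_distr_tendsto S_meas I_meas lim t)
    moreover have "(\<lambda>n. complex_of_real (exp (- (expectation (\<lambda>\<omega>. (?S n t \<omega>)\<^sup>2) * u\<^sup>2 / 2))))
        \<longlonglongrightarrow> of_real (exp (- (?H * u\<^sup>2 / 2)))"
      using late by (intro tendsto_intros step_integral_variance_tendsto xs t b fin)
        (auto elim!: eventually_mono intro: err)
    moreover have "char (distr M borel (?S n t)) u
        = of_real (exp (- (expectation (\<lambda>\<omega>. (?S n t \<omega>)\<^sup>2) * u\<^sup>2 / 2)))" for n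
      unfolding xs_def by (rule grid_integral_gaussian[OF t])
    ultimately show "char (distr M borel (I t)) u = of_real (exp (- (?H * u\<^sup>2 / 2)))"
      using LIMSEQ_unique by fastforce
  qed
qed

end

subsection \<open>Quantile transform and hitting times\<close>

text \<open>The density is positive everywhere, so a null set of the normal law is a Lebesgue null
  set, which a nondegenerate interval is not.\<close>

lemma std_normal_Ioc_pos:
  assumes "x < y"
  shows "0 < measure std_normal_distribution {x<..y}"
proof (rule ccontr)
  interpret real_distribution std_normal_distribution by (rule real_dist_normal_dist)
  assume "\<not> ?thesis"
  then have "measure std_normal_distribution {x<..y} = 0"
    using measure_nonneg[of std_normal_distribution "{x<..y}"] by linarith
  then have "{x<..y} \<in> null_sets std_normal_distribution"
    by (intro null_setsI) (auto simp: emeasure_eq_measure)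
  then have "AE s in lborel. s \<in> {x<..y} \<longrightarrow> ennreal (std_normal_density s) = 0"
    by (subst (asm) null_sets_density_iff) auto
  then have "AE s in lborel. s \<notin> {x<..y}"
  proof eventually_elim
    case (elim s)
    then show ?case
      using normal_density_pos[of 1 0 s] by (auto simp: ennreal_eq_0_iff)
  qed
  then have "{x<..y} \<in> null_sets lborel"
    by (subst AE_iff_null_sets) auto
  then show False using assms by (auto simp: null_sets_def)
qed

lemma cdf_std_normal_strict_mono: "strict_mono (cdf std_normal_distribution)"
proof (rule strict_monoI)
  interpret real_distribution std_normal_distribution by (rule real_dist_normal_dist)
  fix x y :: real assume "x < y"
  then show "cdf std_normal_distribution x < cdf std_normal_distribution y"
    using cdf_diff_eq[of x y] std_normal_Ioc_pos[of x y] by linarith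
qed

lemma cdf_std_normal_bounds: "0 < cdf std_normal_distribution z" "cdf std_normal_distribution z < 1"
proof -
  interpret real_distribution std_normal_distribution by (rule real_dist_normal_dist)
  have "cdf std_normal_distribution (z - 1) < cdf std_normal_distribution z"
    "cdf std_normal_distribution z < cdf std_normal_distribution (z + 1)"
    by (intro strict_monoD[OF cdf_std_normal_strict_mono]; simp)+
  then show "0 < cdf std_normal_distribution z" "cdf std_normal_distribution z < 1"
    using cdf_nonneg[of "z - 1"] cdf_bounded_prob[of "z + 1"] by linarith+
qed

text \<open>A law with a density has no atoms, so its distribution function is continuous; its
  limits at infinity and the intermediate value theorem do the rest.\<close>

lemma cdf_std_normal_surj:
  assumes "0 < y" "y < 1"
  obtains z where "cdf std_normal_distribution z = y"
proof -
  interpret real_distribution std_normal_distribution by (rule real_dist_normal_dist)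
  have cont: "isCont (cdf std_normal_distribution) x" for x
  proof -
    have "AE s in lborel. s \<in> {x} \<longrightarrow> ennreal (std_normal_density s) = 0"
      using AE_lborel_singleton[of x] by eventually_elim simp
    then have "{x} \<in> null_sets std_normal_distribution"
      by (subst null_sets_density_iff) simp_all
    then have "measure std_normal_distribution {x} = 0" by (simp add: null_sets_def measure_def)
    then show ?thesis by (simp add: isCont_cdf)
  qed
  have "\<exists>a. cdf std_normal_distribution a < y"
    using order_tendstoD(2)[OF cdf_lim_at_bot assms(1)]
    by (auto simp: eventually_at_bot_linorder)
  then obtain a where a: "cdf std_normal_distribution a < y" by blast
  have "\<exists>b. y < cdf std_normal_distribution b"
    using order_tendstoD(1)[OF cdf_lim_at_top_prob assms(2)]
    by (auto simp: eventually_at_top_linorder)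
  then obtain b where b: "y < cdf std_normal_distribution b" by blast
  have "a \<le> b"
    using a b strict_mono_less[OF cdf_std_normal_strict_mono, of a b] by linarith
  then show ?thesis
    using IVT[of "cdf std_normal_distribution" a y b] a b cont that by auto
qed

context cdf_distribution
begin

text \<open>In this context \<open>M\<close> is the target law. Its quantile function and its cdf
  form a Galois connection for levels strictly between 0 and 1, where the normal cdf takes its
  values.\<close>

lemma g_fun_le_iff: "g_fun M z \<le> x \<longleftrightarrow> cdf std_normal_distribution z \<le> cdf M x"
  unfolding g_fun_def quantile_def
  using pseudoinverse[of "cdf std_normal_distribution z" x] cdf_std_normal_bounds by simp

lemma mono_g_fun: "mono (g_fun M)"
proof (rule monoI)
  fix x y :: real assume "x \<le> y"
  then have "cdf std_normal_distribution x \<le> cdf std_normal_distribution y"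
    by (simp add: strict_mono_less_eq[OF cdf_std_normal_strict_mono])
  also have "\<dots> \<le> cdf M (g_fun M y)" using g_fun_le_iff by blast
  finally show "g_fun M x \<le> g_fun M y" using g_fun_le_iff by blast
qed

text \<open>Inverse transform sampling: the set where \<open>g_fun M z \<le> x\<close> is a half
  line when \<open>cdf M x\<close> lies strictly between 0 and 1, and otherwise empty or
  everything.\<close>

lemma distr_g_fun: "distr std_normal_distribution borel (g_fun M) = M"
proof (intro cdf_unique ext)
  interpret N: real_distribution std_normal_distribution by (rule real_dist_normal_dist)
  have [measurable]: "g_fun M \<in> borel_measurable borel"
    by (rule borel_measurable_mono[OF mono_g_fun])
  show "real_distribution (distr std_normal_distribution borel (g_fun M))"
    by (intro N.real_distribution_distr) simp
  show "real_distribution M" ..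
  fix x
  have "cdf (distr std_normal_distribution borel (g_fun M)) x
      = measure std_normal_distribution {z. cdf std_normal_distribution z \<le> cdf M x}"
    by (simp add: cdf_def[of "distr _ _ _"] measure_distr vimage_def g_fun_le_iff)
  also have "\<dots> = cdf M x"
  proof -
    consider "cdf M x = 0" | "cdf M x = 1" | "0 < cdf M x" "cdf M x < 1"
      using cdf_nonneg[of x] cdf_bounded_prob[of x] by linarith
    then show ?thesis
    proof cases
      case 1
      then have "{z. cdf std_normal_distribution z \<le> cdf M x} = {}"
        using cdf_std_normal_bounds(1) by (auto simp: not_le)
      then show ?thesis using 1 by simp
    next
      case 2
      then have "{z. cdf std_normal_distribution z \<le> cdf M x} = UNIV"
        using cdf_std_normal_bounds(2) by (auto intro: less_imp_le)
      then show ?thesis using 2 N.prob_space by simp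
    next
      case 3
      then obtain y where y: "cdf std_normal_distribution y = cdf M x"
        by (rule cdf_std_normal_surj)
      have "{z. cdf std_normal_distribution z \<le> cdf M x} = {..y}"
        by (auto simp: y[symmetric] strict_mono_less_eq[OF cdf_std_normal_strict_mono])
      then have "measure std_normal_distribution {z. cdf std_normal_distribution z \<le> cdf M x}
          = cdf std_normal_distribution y"
        by (simp only: cdf_def)
      then show ?thesis by (simp only: y)
    qed
  qed
  finally show "cdf (distr std_normal_distribution borel (g_fun M)) x = cdf M x" .
qed

end

text \<open>On compact intervals the integral agrees with the gauge integral, whose indefinite
  integral is continuous.\<close>

lemma continuous_on_set_integral:
  fixes f :: "real \<Rightarrow> real"
  assumes "\<And>t. 0 \<le> t \<Longrightarrow> set_integrable lborel {0..t} f"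
  shows "continuous_on {0..} (\<lambda>t. LINT s:{0..t}|lborel. f s)"
proof (rule continuous_on_atLeast_0I)
  fix n :: nat
  have "f integrable_on {0..real n}"
    using assms by (intro set_borel_integral_eq_integral) auto
  then have "continuous_on {0..real n} (\<lambda>t. integral {0..t} f)"
    by (rule indefinite_integral_continuous_1)
  then show "continuous_on {0..real n} (\<lambda>t. LINT s:{0..t}|lborel. f s)"
    using assms by (subst continuous_on_cong[OF refl]) (auto simp: set_borel_integral_eq_integral(2))
qed

lemma set_integral_0: "(LINT s:{0..0::real}|lborel. f s) = (0 :: real)"
proof -
  have eq: "(\<lambda>s. indicator {0..0} s *\<^sub>R f s) = (\<lambda>s. f 0 * indicator {0} s)"
    by (auto simp: indicator_def)
  show ?thesis unfolding set_lebesgue_integral_def eq by simp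
qed

text \<open>The selected time is the first zero. It is at most \<open>a\<close> iff a zero lies in
  \<open>{0..a}\<close>, that is, iff \<open>\<bar>D q \<omega>\<bar>\<close> gets arbitrarily small
  at rational \<open>q\<close> in \<open>{0..a}\<close>, which is a countable condition.\<close>

lemma measurable_zero_selection:
  fixes D :: "real \<Rightarrow> 'a \<Rightarrow> real"
  assumes "0 \<le> T"
    and meas: "\<And>t. 0 \<le> t \<Longrightarrow> t \<le> T \<Longrightarrow> D t \<in> borel_measurable M"
    and cont: "\<And>\<omega>. \<omega> \<in> space M \<Longrightarrow> continuous_on {0..T} (\<lambda>t. D t \<omega>)"
    and zero: "\<And>\<omega>. \<omega> \<in> space M \<Longrightarrow> \<exists>t\<in>{0..T}. D t \<omega> = 0"
  shows "\<exists>\<tau>\<in>borel_measurable M. \<forall>\<omega>\<in>space M. 0 \<le> \<tau> \<omega> \<and> \<tau> \<omega> \<le> T \<and> D (\<tau> \<omega>) \<omega> = 0"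
proof -
  define Z where "Z \<omega> = {t\<in>{0..T}. D t \<omega> = 0}" for \<omega>
  define \<tau> where "\<tau> \<omega> = Inf (Z \<omega>)" for \<omega>
  have bdd: "bdd_below (Z \<omega>)" for \<omega> by (rule bdd_belowI[of _ 0]) (auto simp: Z_def)
  have \<tau>_in: "\<tau> \<omega> \<in> Z \<omega>" if "\<omega> \<in> space M" for \<omega>
    unfolding \<tau>_def
  proof (rule closed_contains_Inf[OF _ bdd])
    show "Z \<omega> \<noteq> {}" using zero[OF that] by (auto simp: Z_def)
    have "closed ({0..T} \<inter> (\<lambda>t. D t \<omega>) -` {0})"
      by (rule continuous_closed_preimage[OF cont[OF that]]) auto
    then show "closed (Z \<omega>)" by (simp add: Z_def Int_def vimage_def)
  qed
  show ?thesis
  proof (intro bexI[of _ \<tau>] ballI)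
    show "0 \<le> \<tau> \<omega> \<and> \<tau> \<omega> \<le> T \<and> D (\<tau> \<omega>) \<omega> = 0" if "\<omega> \<in> space M" for \<omega>
      using \<tau>_in[OF that] by (simp add: Z_def)
    show "\<tau> \<in> borel_measurable M"
      unfolding borel_measurable_iff_le
    proof
      fix a :: real
      consider "a < 0" | "T \<le> a" | "0 \<le> a" "a \<le> T" by linarith
      then show "{\<omega> \<in> space M. \<tau> \<omega> \<le> a} \<in> sets M"
      proof cases
        case 1
        then have "{\<omega> \<in> space M. \<tau> \<omega> \<le> a} = {}" using \<tau>_in by (force simp: Z_def)
        then show ?thesis by (metis sets.empty_sets)
      next
        case 2
        then have "{\<omega> \<in> space M. \<tau> \<omega> \<le> a} = space M" using \<tau>_in by (force simp: Z_def)
        then show ?thesis by (metis sets.top)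
      next
        case 3
        let ?C = "\<rat> \<inter> {0..a}"
        have "{\<omega> \<in> space M. \<tau> \<omega> \<le> a}
            = (\<Inter>k::nat. \<Union>q\<in>?C. {\<omega> \<in> space M. \<bar>D q \<omega>\<bar> < 1 / real (Suc k)})"
        proof (intro equalityI subsetI)
          fix \<omega> assume \<omega>: "\<omega> \<in> {\<omega> \<in> space M. \<tau> \<omega> \<le> a}"
          then have \<tau>: "\<tau> \<omega> \<in> {0..a}" "D (\<tau> \<omega>) \<omega> = 0" using \<tau>_in[of \<omega>] by (auto simp: Z_def)
          have "\<exists>q\<in>?C. \<bar>D q \<omega>\<bar> < e" if "0 < e" for e
          proof -
            have "continuous_on {0..a} (\<lambda>t. D t \<omega>)"
              using cont[of \<omega>] \<omega> 3 by (auto intro: continuous_on_subset)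
            then obtain d where d: "0 < d" "\<And>t. t \<in> {0..a} \<Longrightarrow> dist t (\<tau> \<omega>) < d \<Longrightarrow> dist (D t \<omega>) (D (\<tau> \<omega>) \<omega>) < e"
              using \<tau>(1) \<open>0 < e\<close> unfolding continuous_on_iff by metis
            have "\<tau> \<omega> \<in> closure ?C" using closure_rationals_interval[OF 3(1)] \<tau>(1) by blast
            then obtain q where "q \<in> ?C" "dist q (\<tau> \<omega>) < d"
              using d(1) unfolding closure_approachable by blast
            then show ?thesis using d(2)[of q] \<tau>(2) by (auto simp: dist_real_def)
          qed
          then show "\<omega> \<in> (\<Inter>k::nat. \<Union>q\<in>?C. {\<omega> \<in> space M. \<bar>D q \<omega>\<bar> < 1 / real (Suc k)})"
            using \<omega> by auto
        next
          fix \<omega> assume *: "\<omega> \<in> (\<Inter>k::nat. \<Union>q\<in>?C. {\<omega> \<in> space M. \<bar>D q \<omega>\<bar> < 1 / real (Suc k)})"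
          then have \<omega>: "\<omega> \<in> space M" by auto
          \<comment> \<open>By compactness \<open>\<bar>D t \<omega>\<bar>\<close> attains its
            minimum over \<open>{0..a}\<close>; being below every \<open>1 / real (Suc k)\<close>,
            the minimum is 0.\<close>
          have "continuous_on {0..a} (\<lambda>t. \<bar>D t \<omega>\<bar>)"
            using cont[OF \<omega>] 3 by (intro continuous_intros) (auto intro: continuous_on_subset)
          then obtain t where t: "t \<in> {0..a}" "\<And>s. s \<in> {0..a} \<Longrightarrow> \<bar>D t \<omega>\<bar> \<le> \<bar>D s \<omega>\<bar>"
            using continuous_attains_inf[of "{0..a}" "\<lambda>t. \<bar>D t \<omega>\<bar>"] 3 by auto
          have "\<not> 0 < \<bar>D t \<omega>\<bar>"
          proof
            assume "0 < \<bar>D t \<omega>\<bar>"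
            then obtain k :: nat where k: "1 / real (Suc k) < \<bar>D t \<omega>\<bar>"
              using nat_approx_posE by blast
            from * obtain q where "q \<in> ?C" "\<bar>D q \<omega>\<bar> < 1 / real (Suc k)" by blast
            then show False using t(2)[of q] k by auto
          qed
          then have "t \<in> Z \<omega>" using t(1) 3 by (auto simp: Z_def)
          then have "\<tau> \<omega> \<le> t" unfolding \<tau>_def by (rule cInf_lower[OF _ bdd])
          then show "\<omega> \<in> {\<omega> \<in> space M. \<tau> \<omega> \<le> a}" using \<omega> t(1) by auto
        qed
        also have "\<dots> \<in> sets M"
        proof (rule sets.countable_INT, safe)
          fix k :: nat
          have "{\<omega> \<in> space M. \<bar>D q \<omega>\<bar> < 1 / real (Suc k)} \<in> sets M" if "q \<in> ?C" for q
          proof -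
            have [measurable]: "D q \<in> borel_measurable M" using that 3 by (intro meas) auto
            show ?thesis by measurable
          qed
          then show "(\<Union>q\<in>?C. {\<omega> \<in> space M. \<bar>D q \<omega>\<bar> < 1 / real (Suc k)}) \<in> sets M"
            by (intro sets.countable_UN'' countable_Int1 countable_rat)
        qed
        finally show ?thesis .
      qed
    qed
  qed
qed

subsection \<open>The embedding\<close>

text \<open>Measurability of \<open>f\<close> is given only on the half line; multiplication by an
  indicator transfers it to the real line.\<close>

lemma set_integrable_Icc_0I:
  fixes f :: "real \<Rightarrow> real"
  assumes "f \<in> borel_measurable (restrict_space borel {0..})"
    and "(\<integral>\<^sup>+s\<in>{0..t}. ennreal \<bar>f s\<bar> \<partial>lborel) < \<infinity>"
  shows "set_integrable lborel {0..t} f"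
  unfolding set_integrable_def
proof (rule integrableI_bounded)
  have "(\<lambda>s. indicator {0..} s *\<^sub>R f s) \<in> borel_measurable borel"
    using assms(1) by (subst (asm) borel_measurable_restrict_space_iff) auto
  then have "(\<lambda>s. indicator {0..t} s *\<^sub>R (indicator {0..} s *\<^sub>R f s)) \<in> borel_measurable borel"
    by measurable
  also have "(\<lambda>s. indicator {0..t} s *\<^sub>R (indicator {0..} s *\<^sub>R f s)) = (\<lambda>s. indicator {0..t} s *\<^sub>R f s)"
    by (auto simp: indicator_def)
  finally show "(\<lambda>s. indicator {0..t} s *\<^sub>R f s) \<in> borel_measurable lborel" by simp
  have "(\<integral>\<^sup>+s. ennreal (norm (indicator {0..t} s *\<^sub>R f s)) \<partial>lborel) = (\<integral>\<^sup>+s\<in>{0..t}. ennreal \<bar>f s\<bar> \<partial>lborel)"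
    by (intro nn_integral_cong) (auto simp: indicator_def)
  then show "(\<integral>\<^sup>+s. ennreal (norm (indicator {0..t} s *\<^sub>R f s)) \<partial>lborel) < \<infinity>"
    using assms(2) by simp
qed

text \<open>Serves twice: it makes H reach every level, and it forces T = 0 when the Lipschitz
  constant of g is 0.\<close>

lemma H_fun_lower_bound:
  assumes int: "set_integrable lborel {0..t} (\<lambda>s. (\<beta> s)\<^sup>2)" and "0 \<le> t" "0 \<le> \<epsilon>"
    and low: "\<And>s. 0 \<le> s \<Longrightarrow> \<epsilon> \<le> \<bar>\<beta> s\<bar>"
  shows "\<epsilon>\<^sup>2 * t \<le> H_fun \<beta> t"
proof -
  have "(LINT s:{0..t}|lborel. \<epsilon>\<^sup>2) \<le> (LINT s:{0..t}|lborel. (\<beta> s)\<^sup>2)"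
  proof (rule set_integral_mono[OF _ int])
    show "set_integrable lborel {0..t} (\<lambda>s. \<epsilon>\<^sup>2)"
      unfolding set_integrable_def by (intro integrable_scaleR_left integrable_real_indicator emeasure_bounded_finite) auto
    fix s assume "s \<in> {0..t}"
    then have "\<bar>\<epsilon>\<bar> \<le> \<bar>\<beta> s\<bar>" using low[of s] \<open>0 \<le> \<epsilon>\<close> by simp
    then show "\<epsilon>\<^sup>2 \<le> (\<beta> s)\<^sup>2" by (simp only: abs_le_square_iff)
  qed
  then show ?thesis using \<open>0 \<le> t\<close> by (simp add: H_fun_def set_lebesgue_integral_def mult.commute)
qed

text \<open>H vanishes at 0 and is at least \<open>y\<close> at
  \<open>y / \<epsilon>\<^sup>2\<close>, so by continuity \<open>y\<close> has a preimage, and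
  \<open>inv_into\<close> selects one.\<close>

lemma H_inv_inverse:
  assumes int: "\<And>t. 0 \<le> t \<Longrightarrow> set_integrable lborel {0..t} (\<lambda>s. (\<beta> s)\<^sup>2)" and "0 < \<epsilon>"
    and low: "\<And>s. 0 \<le> s \<Longrightarrow> \<epsilon> \<le> \<bar>\<beta> s\<bar>" and "0 \<le> y"
  shows "0 \<le> H_inv \<beta> y" "H_fun \<beta> (H_inv \<beta> y) = y"
proof -
  define t where "t = y / \<epsilon>\<^sup>2"
  have "0 \<le> t" using assms by (simp add: t_def)
  have "\<epsilon>\<^sup>2 * t = y" using \<open>0 < \<epsilon>\<close> by (simp add: t_def)
  then have "y \<le> H_fun \<beta> t"
    using H_fun_lower_bound[OF int[OF \<open>0 \<le> t\<close>] \<open>0 \<le> t\<close> _ low] \<open>0 < \<epsilon>\<close> by simp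
  moreover have "H_fun \<beta> 0 \<le> y" using \<open>0 \<le> y\<close> by (simp only: H_fun_def set_integral_0)
  moreover have "continuous_on {0..t} (H_fun \<beta>)"
    unfolding H_fun_def by (rule continuous_on_subset[OF continuous_on_set_integral[OF int]]) auto
  ultimately have "\<exists>x\<ge>0. x \<le> t \<and> H_fun \<beta> x = y"
    using \<open>0 \<le> t\<close> by (intro IVT') auto
  then have "y \<in> H_fun \<beta> ` {0..}" by auto
  then show "0 \<le> H_inv \<beta> y" "H_fun \<beta> (H_inv \<beta> y) = y"
    unfolding H_inv_def using inv_into_into[of y "H_fun \<beta>" "{0..}"] by (auto intro: f_inv_into_f)
qed

lemma (in prob_space) distr_std_normalI:
  assumes [measurable]: "X \<in> borel_measurable M"
    and "\<And>u. char (distr M borel X) u = of_real (exp (- (u\<^sup>2 / 2)))"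
  shows "distr M borel X = std_normal_distribution"
proof (rule Levy_uniqueness)
  show "real_distribution (distr M borel X)" by (rule real_distribution_distr) measurable
  show "char (distr M borel X) = char std_normal_distribution"
    using assms(2) by (simp add: fun_eq_iff char_std_normal_distribution)
qed (rule real_dist_normal_dist)

text \<open>Leads back from the extension of \<beta> by 0, for which the integral is constructed, to
  \<beta> itself.\<close>

lemma is_stochastic_integral_cong:
  assumes "is_stochastic_integral M b B I" and "\<And>s. 0 \<le> s \<Longrightarrow> b s = \<beta> s"
  shows "is_stochastic_integral M \<beta> B I"
proof -
  have "(\<integral>\<^sup>+s\<in>{0..t}. ennreal ((step_fun xs s - \<beta> s)\<^sup>2) \<partial>lborel)
      = (\<integral>\<^sup>+s\<in>{0..t}. ennreal ((step_fun xs s - b s)\<^sup>2) \<partial>lborel)" for xs t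
    by (intro nn_integral_cong) (auto simp: indicator_def assms(2))
  then show ?thesis using assms(1) unfolding is_stochastic_integral_def by simp
qed

theorem theorem4p3:
  fixes M :: "'a measure" and \<F> :: "real \<Rightarrow> 'a measure" and W :: "real \<Rightarrow> 'a \<Rightarrow> real"
    and \<nu> :: "real measure" and G0 L\<^sub>g L\<^sub>\<delta> :: real and \<alpha> \<beta> :: "real \<Rightarrow> real"
  assumes "brownian_motion M W"
    and "\<forall>t\<ge>0. \<F> t = augmented_filtration M W t"
    and "real_distribution \<nu>"
    and "\<alpha> \<in> borel_measurable (restrict_space borel {0..})"
    and "\<beta> \<in> borel_measurable (restrict_space borel {0..})"
    and "\<forall>t\<ge>0. (\<integral>\<^sup>+s\<in>{0..t}. ennreal \<bar>\<alpha> s\<bar> \<partial>lborel) + (\<integral>\<^sup>+s\<in>{0..t}. ennreal ((\<beta> s)\<^sup>2) \<partial>lborel) < \<infinity>"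
    and "(INF s\<in>{0..}. \<bar>\<beta> s\<bar>) > 0"
    and "L\<^sub>g-lipschitz_on UNIV (g_fun \<nu>)"
    and "L\<^sub>\<delta>-lipschitz_on {0..} (delta_fun G0 \<alpha> \<beta>)"
  shows "\<exists>(B :: real \<Rightarrow> 'a \<Rightarrow> real) (I :: real \<Rightarrow> 'a \<Rightarrow> real) (\<tau> :: 'a \<Rightarrow> real) (c :: real).
           brownian_motion M B \<and> is_stochastic_integral M \<beta> B I \<and>
           random_time M \<tau> \<and> (\<forall>\<omega>\<in>space M. \<tau> \<omega> \<le> H_inv \<beta> (L\<^sub>g\<^sup>2)) \<and>
           (\<lambda>\<omega>. c + (LINT s:{0..\<tau> \<omega>}|lborel. \<alpha> s) + I (\<tau> \<omega>) \<omega>) \<in> borel_measurable M \<and>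
           distr M borel (\<lambda>\<omega>. c + (LINT s:{0..\<tau> \<omega>}|lborel. \<alpha> s) + I (\<tau> \<omega>) \<omega>) = \<nu>"
proof -
  interpret brownian_motion M W by fact
  interpret \<nu>: cdf_distribution \<nu> using assms(3) by (simp add: cdf_distribution_def)
  \<comment> \<open>\<beta> is measurable on the half line only; its extension by 0 is Borel on the
    real line and has the same integrals over \<open>{0..t}\<close>.\<close>
  define b where "b s = indicator {0..} s * \<beta> s" for s
  define \<epsilon> where "\<epsilon> = (INF s\<in>{0..}. \<bar>\<beta> s\<bar>)"
  have "0 < \<epsilon>" using assms(7) by (simp add: \<epsilon>_def)
  have low: "\<epsilon> \<le> \<bar>\<beta> s\<bar>" if "0 \<le> s" for s
    unfolding \<epsilon>_def using that by (intro cINF_lower bdd_belowI2[of _ 0]) auto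
  have fin: "(\<integral>\<^sup>+s\<in>{0..t}. ennreal \<bar>\<alpha> s\<bar> \<partial>lborel) < \<infinity>" "(\<integral>\<^sup>+s\<in>{0..t}. ennreal ((\<beta> s)\<^sup>2) \<partial>lborel) < \<infinity>"
    if "0 \<le> t" for t
    using assms(6) that by (auto simp: less_top[symmetric])
  have int_\<alpha>: "set_integrable lborel {0..t} \<alpha>" if "0 \<le> t" for t
    using assms(4) fin(1)[OF that] by (rule set_integrable_Icc_0I)
  have int_\<beta>: "set_integrable lborel {0..t} (\<lambda>s. (\<beta> s)\<^sup>2)" if "0 \<le> t" for t
    using assms(5) fin(2)[OF that] by (intro set_integrable_Icc_0I borel_measurable_power) auto
  define T where "T = H_inv \<beta> (L\<^sub>g\<^sup>2)"
  have T: "0 \<le> T" "H_fun \<beta> T = L\<^sub>g\<^sup>2"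
    using H_inv_inverse[OF int_\<beta> \<open>0 < \<epsilon>\<close> low] by (auto simp: T_def)
  have "0 \<le> L\<^sub>g" using assms(8) by (rule lipschitz_on_nonneg)

  have b_meas: "b \<in> borel_measurable borel"
    using assms(5) by (subst (asm) borel_measurable_restrict_space_iff) (auto simp: b_def[abs_def])
  have b_fin: "(\<integral>\<^sup>+s\<in>{0..t}. ennreal ((b s)\<^sup>2) \<partial>lborel) < \<infinity>" if "0 \<le> t" for t
  proof -
    have "(\<integral>\<^sup>+s\<in>{0..t}. ennreal ((b s)\<^sup>2) \<partial>lborel) = (\<integral>\<^sup>+s\<in>{0..t}. ennreal ((\<beta> s)\<^sup>2) \<partial>lborel)"
      by (intro nn_integral_cong) (auto simp: b_def indicator_def)
    then show ?thesis using fin(2)[OF that] by simp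
  qed
  obtain I where I_b: "is_stochastic_integral M b W I" and I_0: "\<And>\<omega>. I 0 \<omega> = 0"
    and I_char: "\<And>t u. 0 \<le> t \<Longrightarrow> char (distr M borel (I t)) u
      = of_real (exp (- ((LINT s:{0..t}|lborel. (b s)\<^sup>2) * u\<^sup>2 / 2)))"
    using wiener_integral_exists[OF b_meas b_fin] by blast
  have I: "is_stochastic_integral M \<beta> W I"
    using I_b by (rule is_stochastic_integral_cong) (simp add: b_def)
  have I_meas [measurable]: "I t \<in> borel_measurable M" if "0 \<le> t" for t
    using I that by (simp add: is_stochastic_integral_def)
  have "(LINT s:{0..T}|lborel. (b s)\<^sup>2) = H_fun \<beta> T"
    unfolding H_fun_def set_lebesgue_integral_def
    by (intro Bochner_Integration.integral_cong) (auto simp: b_def indicator_def)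
  then have I_T: "char (distr M borel (I T)) u = of_real (exp (- (L\<^sub>g\<^sup>2 * u\<^sup>2 / 2)))" for u
    using I_char[OF T(1)] T(2) by simp
  define A where "A t = (LINT s:{0..t}|lborel. \<alpha> s)" for t
  have A_0: "A 0 = 0" by (simp only: A_def set_integral_0)
  have A_cont: "continuous_on {0..} A"
    unfolding A_def by (rule continuous_on_set_integral[OF int_\<alpha>])

  have "\<exists>Z z0. Z \<in> borel_measurable M \<and> distr M borel Z = std_normal_distribution \<and>
    (\<forall>\<omega>. I T \<omega> = L\<^sub>g * Z \<omega>) \<and> A T + L\<^sub>g * z0 = 0"
  \<comment> \<open>If the constant is 0, \<open>I T\<close> cannot be normalised. But then
    \<open>T = 0\<close> and \<open>I T = 0\<close>, so any standard normal variable serves as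
    \<open>Z\<close>, here the increment of \<open>W\<close> over the unit interval.\<close>
  proof (cases "L\<^sub>g = 0")
    case True
    have "\<epsilon>\<^sup>2 * T \<le> 0"
      using H_fun_lower_bound[OF int_\<beta>[OF T(1)] T(1) _ low] \<open>0 < \<epsilon>\<close> T(2) True by simp
    then have "T = 0" using T(1) \<open>0 < \<epsilon>\<close> by (simp add: mult_le_0_iff)
    have incr: "(\<lambda>\<omega>. W 1 \<omega> - W 0 \<omega>) \<in> borel_measurable M"
      by (intro borel_measurable_diff measurable_BM) simp_all
    have "distr M borel (\<lambda>\<omega>. W 1 \<omega> - W 0 \<omega>) = std_normal_distribution"
    proof (rule distr_std_normalI[OF incr])
      have "distributed M lborel (\<lambda>\<omega>. W 1 \<omega> - W 0 \<omega>) (\<lambda>x. ennreal (normal_density 0 1 x))"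
        using normal_increments_BM[of 0 1] by simp
      from char_distr_normal[OF zero_less_one this]
      show "char (distr M borel (\<lambda>\<omega>. W 1 \<omega> - W 0 \<omega>)) u = of_real (exp (- (u\<^sup>2 / 2)))" for u
        by simp
    qed
    moreover have "\<forall>\<omega>. I T \<omega> = L\<^sub>g * (W 1 \<omega> - W 0 \<omega>)" "A T + L\<^sub>g * 0 = 0"
      using I_0 A_0 by (simp_all add: True \<open>T = 0\<close>)
    ultimately show ?thesis using incr by blast
  next
    case False
    have [measurable]: "I T \<in> borel_measurable M" by (rule I_meas[OF T(1)])
    have "distr M borel (\<lambda>\<omega>. (1 / L\<^sub>g) * I T \<omega>) = std_normal_distribution"
    proof (rule distr_std_normalI)
      show "char (distr M borel (\<lambda>\<omega>. (1 / L\<^sub>g) * I T \<omega>)) u = of_real (exp (- (u\<^sup>2 / 2)))" for u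
        unfolding char_distr_mult[OF I_meas[OF T(1)]] I_T using False by (simp add: power_divide)
    qed measurable
    then show ?thesis
      using False by (intro exI[of _ "\<lambda>\<omega>. (1 / L\<^sub>g) * I T \<omega>"] exI[of _ "- A T / L\<^sub>g"]) auto
  qed
  then obtain Z z0 where Z [measurable]: "Z \<in> borel_measurable M"
    and Z_law: "distr M borel Z = std_normal_distribution"
    and I_Z: "\<And>\<omega>. I T \<omega> = L\<^sub>g * Z \<omega>" and z0: "A T + L\<^sub>g * z0 = 0" by blast

  have g_meas [measurable]: "g_fun \<nu> \<in> borel_measurable borel"
    by (rule borel_measurable_mono[OF \<nu>.mono_g_fun])
  \<comment> \<open>A zero of \<open>D\<close> is a time at which the path \<open>A + I\<close>
    attains the target value.\<close>
  define D where "D t \<omega> = A t + I t \<omega> - (g_fun \<nu> (Z \<omega>) - g_fun \<nu> z0)" for t \<omega>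
  have D_cont: "continuous_on {0..T} (\<lambda>t. D t \<omega>)" if "\<omega> \<in> space M" for \<omega>
  proof -
    have "continuous_on {0..} (\<lambda>t. I t \<omega>)" using I that by (simp add: is_stochastic_integral_def)
    then show ?thesis unfolding D_def
      by (intro continuous_intros continuous_on_subset[OF A_cont]) (auto intro: continuous_on_subset)
  qed
  have D_zero: "\<exists>t\<in>{0..T}. D t \<omega> = 0" if \<omega>: "\<omega> \<in> space M" for \<omega>
  proof -
    have D_0: "D 0 \<omega> = g_fun \<nu> z0 - g_fun \<nu> (Z \<omega>)" by (simp add: D_def A_0 I_0)
    have D_T: "D T \<omega> = L\<^sub>g * (Z \<omega> - z0) - (g_fun \<nu> (Z \<omega>) - g_fun \<nu> z0)"
      using z0 by (simp add: D_def I_Z algebra_simps)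
    have lip: "\<bar>g_fun \<nu> (Z \<omega>) - g_fun \<nu> z0\<bar> \<le> L\<^sub>g * \<bar>Z \<omega> - z0\<bar>"
      using lipschitz_onD[OF assms(8), of "Z \<omega>" z0] by (simp add: dist_real_def)
    \<comment> \<open>The order of \<open>z0\<close> and \<open>Z \<omega>\<close> decides the
      signs: monotonicity of g fixes the one at time 0, the Lipschitz bound gives the opposite one
      at \<open>T\<close>.\<close>
    show ?thesis
    proof (cases "z0 \<le> Z \<omega>")
      case True
      then have "g_fun \<nu> z0 \<le> g_fun \<nu> (Z \<omega>)" by (rule monoD[OF \<nu>.mono_g_fun])
      moreover have "L\<^sub>g * \<bar>Z \<omega> - z0\<bar> = L\<^sub>g * (Z \<omega> - z0)" using True by simp
      ultimately have "D 0 \<omega> \<le> 0" "0 \<le> D T \<omega>" using D_0 D_T lip by linarith+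
      then show ?thesis using IVT'[of "\<lambda>t. D t \<omega>" 0 0 T] T(1) D_cont[OF \<omega>] by auto
    next
      case False
      then have "g_fun \<nu> (Z \<omega>) \<le> g_fun \<nu> z0" by (intro monoD[OF \<nu>.mono_g_fun]) simp
      moreover have "\<bar>Z \<omega> - z0\<bar> = - (Z \<omega> - z0)" using False by simp
      then have "L\<^sub>g * \<bar>Z \<omega> - z0\<bar> = - (L\<^sub>g * (Z \<omega> - z0))" by (simp only: mult_minus_right)
      ultimately have "0 \<le> D 0 \<omega>" "D T \<omega> \<le> 0" using D_0 D_T lip by linarith+
      then show ?thesis using IVT2'[of "\<lambda>t. D t \<omega>" T 0 0] T(1) D_cont[OF \<omega>] by auto
    qed
  qed
  have D_meas: "D t \<in> borel_measurable M" if "0 \<le> t" for t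
  proof -
    have [measurable]: "I t \<in> borel_measurable M" by (rule I_meas[OF that])
    show ?thesis unfolding D_def by measurable
  qed
  have "\<exists>\<tau>\<in>borel_measurable M. \<forall>\<omega>\<in>space M. 0 \<le> \<tau> \<omega> \<and> \<tau> \<omega> \<le> T \<and> D (\<tau> \<omega>) \<omega> = 0"
    by (intro measurable_zero_selection T(1) D_meas D_cont D_zero)
  then obtain \<tau> where \<tau>_meas: "\<tau> \<in> borel_measurable M"
    and \<tau>: "\<And>\<omega>. \<omega> \<in> space M \<Longrightarrow> 0 \<le> \<tau> \<omega> \<and> \<tau> \<omega> \<le> T \<and> D (\<tau> \<omega>) \<omega> = 0"
    by blast
  let ?c = "g_fun \<nu> z0"
  let ?X = "\<lambda>\<omega>. ?c + (LINT s:{0..\<tau> \<omega>}|lborel. \<alpha> s) + I (\<tau> \<omega>) \<omega>"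
  \<comment> \<open>This holds at every point of the space, not only almost surely, so measurability
    and law are those of g applied to \<open>Z\<close>.\<close>
  have X: "?X \<omega> = g_fun \<nu> (Z \<omega>)" if "\<omega> \<in> space M" for \<omega>
    using \<tau>[OF that] by (simp add: D_def A_def)
  have X_meas: "?X \<in> borel_measurable M"
    using X by (subst measurable_cong[where g="\<lambda>\<omega>. g_fun \<nu> (Z \<omega>)"]) auto
  have "distr M borel ?X = distr M borel (\<lambda>\<omega>. g_fun \<nu> (Z \<omega>))"
    by (intro distr_cong X) auto
  also have "\<dots> = distr (distr M borel Z) borel (g_fun \<nu>)"
    by (subst distr_distr) (auto simp: o_def)
  also have "\<dots> = \<nu>" unfolding Z_law by (rule \<nu>.distr_g_fun)
  finally have "distr M borel ?X = \<nu>" .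
  moreover have "random_time M \<tau>" "\<forall>\<omega>\<in>space M. \<tau> \<omega> \<le> H_inv \<beta> (L\<^sub>g\<^sup>2)"
    using \<tau>_meas \<tau> by (auto simp: random_time_def T_def)
  ultimately show ?thesis
    using assms(1) I X_meas by (intro exI[of _ W] exI[of _ I] exI[of _ \<tau>] exI[of _ ?c] conjI)
qed

end
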